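(* Let $(M,g)$ be a two-dimensional oriented Riemannian manifold whose curvature $K$ vanishes nowhere, and let $\hat g$ be the Wagner lift of $g$ to $SO(M,g)$. For any $\hat f\in I_p(SO(M,g),\hat g)$, $\pi_*(\hat f)\in I(M,g)$.
   Context: Let $\pi:SO(M,g)\to M$ be the principal $SO(2)$-bundle of positively oriented orthonormal frames, with right action $\{e_1,e_2\}\cdot r(\varphi)=\{\cos\varphi\, e_1+\sin\varphi\, e_2,\,-\sin\varphi\, e_1+\cos\varphi\, e_2\}$. The Levi-Civita connection of $g$ determines the $SO(2)$-invariant horizontal distribution $\mathcal{H}$ on $SO(M,g)$, complementary to the vertical distribution $V$ (tangent to the fibers). Let $\partial_\varphi|_p=\frac{d}{d\varphi}|_{\varphi=0}\, p\cdot r(\varphi)$; it spans $V$. The Wagner lift $\hat g$ of $g$ (for $K$ nowhere zero) is the Riemannian metric on $SO(M,g)$ defined by: $\hat g(X,Y)_p=g(d\pi X,d\pi Y)$ for $X,Y\in\mathcal{H}_p$; $\hat g(X,Y)_p=0$ for $X\in\mathcal{H}_p$, $Y\in V_p$; and $\hat g(\partial_\varphi,\partial_\varphi)_p=1/K^2(\pi(p))$. Convention: only isometries preserving orientation are considered. With this convention, $I(N,h)$ denotes the isometry group of a Riemannian manifold $(N,h)$; in particular $I(M,g)$ is the group of orientation-preserving isometries of $(M,g)$. A diffeomorphism $\hat f:SO(M,g)\to SO(M,g)$ is called projectable if there is a diffeomorphism $f:M\to M$ with $\pi\circ\hat f=f\circ\pi$; then one writes $f=\pi_*(\hat f)$.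 $I_p(SO(M,g),\hat g)$ denotes the Lie group of projectable isometries of $(SO(M,g),\hat g)$.
   Formalization: Isometries in I_p are also required to preserve the orientation of the fibres (a reflection of the round sphere lifts to a counterexample otherwise); for all projectable isometries, with no orientation condition, the projection is shown to be an isometry. *)

theory Defs
  imports "HOL-Analysis.Analysis"
begin

section \<open>Smooth manifolds given by an atlas\<close>

text \<open>Iterated Frechet differentiability, used only for open \<open>S\<close>; a function is \<open>C\<^sup>k\<^sup>+\<^sup>1\<close> if it is
  differentiable and all its directional derivatives are \<open>C\<^sup>k\<close>.\<close>

primrec Ck_on :: "nat \<Rightarrow> 'a::euclidean_space set \<Rightarrow> ('a \<Rightarrow> 'b::real_normed_vector) \<Rightarrow> bool" where
  "Ck_on 0 S f \<longleftrightarrow> continuous_on S f"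
| "Ck_on (Suc k) S f \<longleftrightarrow>
     (\<forall>x\<in>S. f differentiable (at x)) \<and> (\<forall>v. Ck_on k S (\<lambda>x. frechet_derivative f (at x) v))"

definition smooth_on :: "'a::euclidean_space set \<Rightarrow> ('a \<Rightarrow> 'b::real_normed_vector) \<Rightarrow> bool" where
  "smooth_on S f \<longleftrightarrow> (\<forall>k. Ck_on k S f)"

text \<open>A chart is a pair of its domain and its coordinate map (which is irrelevant off the domain).\<close>

type_synonym ('a, 'n) chart = "'a set \<times> ('a \<Rightarrow> real^'n)"

definition carrier :: "('a, 'n::finite) chart set \<Rightarrow> 'a set" where
  "carrier A = (\<Union>c\<in>A. fst c)"

definition chart_inv :: "('a, 'n::finite) chart \<Rightarrow> real^'n \<Rightarrow> 'a" where
  "chart_inv c = inv_into (fst c) (snd c)"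

definition chart_at :: "('a, 'n::finite) chart set \<Rightarrow> 'a \<Rightarrow> ('a, 'n) chart" where
  "chart_at A x = (SOME c. c \<in> A \<and> x \<in> fst c)"

text \<open>The first clause, openness of the domain of each coordinate representation of \<open>f\<close>,
  is continuity of \<open>f\<close> with respect to the topologies induced by the atlases.\<close>

definition smooth_map ::
    "('a, 'n::finite) chart set \<Rightarrow> ('b, 'm::finite) chart set \<Rightarrow> ('a \<Rightarrow> 'b) \<Rightarrow> bool" where
  "smooth_map A B f \<longleftrightarrow> f ` carrier A \<subseteq> carrier B \<and>
     (\<forall>c\<in>A. \<forall>c'\<in>B. let W = snd c ` (fst c \<inter> f -` fst c') in
        open W \<and> smooth_on W (snd c' \<circ> f \<circ> chart_inv c))"

definition diffeomorphism ::
    "('a, 'n::finite) chart set \<Rightarrow> ('b, 'n) chart set \<Rightarrow> ('a \<Rightarrow> 'b) \<Rightarrow> bool" where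
  "diffeomorphism A B f \<longleftrightarrow> bij_betw f (carrier A) (carrier B) \<and>
     smooth_map A B f \<and> smooth_map B A (inv_into (carrier A) f)"

text \<open>Positive Jacobian determinants in all charts of \<open>A\<close> and \<open>B\<close>, which are meant to be oriented
  atlases.\<close>

definition orientation_preserving ::
    "('a, 'n::finite) chart set \<Rightarrow> ('b, 'n) chart set \<Rightarrow> ('a \<Rightarrow> 'b) \<Rightarrow> bool" where
  "orientation_preserving A B f \<longleftrightarrow>
     (\<forall>c\<in>A. \<forall>c'\<in>B. \<forall>p\<in>fst c. f p \<in> fst c' \<longrightarrow>
        det (matrix (frechet_derivative (snd c' \<circ> f \<circ> chart_inv c) (at (snd c p)))) > 0)"

text \<open>An orientation is given by an oriented atlas: for the identity map, the coordinate
  representations in \<^const>\<open>smooth_map\<close> and \<^const>\<open>orientation_preserving\<close> are the transition maps.\<close>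

definition oriented_manifold :: "'a topology \<Rightarrow> ('a, 'n::finite) chart set \<Rightarrow> bool" where
  "oriented_manifold X A \<longleftrightarrow> Hausdorff_space X \<and> second_countable X \<and>
     topspace X = carrier A \<and>
     (\<forall>c\<in>A. openin X (fst c) \<and> open (snd c ` fst c) \<and>
        homeomorphic_map (subtopology X (fst c)) (top_of_set (snd c ` fst c)) (snd c)) \<and>
     smooth_map A A (\<lambda>x. x) \<and> orientation_preserving A A (\<lambda>x. x)"


section \<open>Tangent vectors and Riemannian metrics\<close>

text \<open>A tangent vector at \<open>x\<close> is the family of its coordinate vectors in all the charts around \<open>x\<close>,
  subject to the contravariant transformation law (and \<open>0\<close> at the other charts).\<close>

type_synonym ('a, 'n) tvec = "('a, 'n) chart \<Rightarrow> real^'n"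

definition tangent :: "('a, 'n::finite) chart set \<Rightarrow> 'a \<Rightarrow> ('a, 'n) tvec set" where
  "tangent A x = {v.
     (\<forall>c\<in>A. \<forall>c'\<in>A. x \<in> fst c \<longrightarrow> x \<in> fst c' \<longrightarrow>
        v c' = frechet_derivative (snd c' \<circ> chart_inv c) (at (snd c x)) (v c)) \<and>
     (\<forall>c. \<not> (c \<in> A \<and> x \<in> fst c) \<longrightarrow> v c = 0)}"

text \<open>The tangent vector at \<open>x\<close> with coordinate vector \<open>w\<close> in the chart \<open>c\<close>.\<close>

definition tvec_of ::
    "('a, 'n::finite) chart set \<Rightarrow> ('a, 'n) chart \<Rightarrow> 'a \<Rightarrow> real^'n \<Rightarrow> ('a, 'n) tvec" where
  "tvec_of A c x w = (\<lambda>c'. if c' \<in> A \<and> x \<in> fst c'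
     then frechet_derivative (snd c' \<circ> chart_inv c) (at (snd c x)) w else 0)"

text \<open>The derivative of a vector-valued function \<open>F\<close> on the manifold along the tangent vector \<open>v\<close>
  at \<open>p\<close>; it does not depend on the chart used to compute it.\<close>

definition dir_deriv ::
    "('a, 'n::finite) chart set \<Rightarrow> ('a \<Rightarrow> 'v::real_normed_vector) \<Rightarrow> 'a \<Rightarrow> ('a, 'n) tvec \<Rightarrow> 'v" where
  "dir_deriv A F p v = (let c = chart_at A p in
     frechet_derivative (F \<circ> chart_inv c) (at (snd c p)) (v c))"

definition differential ::
    "('a, 'n::finite) chart set \<Rightarrow> ('b, 'm::finite) chart set \<Rightarrow> ('a \<Rightarrow> 'b) \<Rightarrow> 'a \<Rightarrow>
     ('a, 'n) tvec \<Rightarrow> ('b, 'm) tvec" where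
  "differential A B f p v =
     (\<lambda>c'. if c' \<in> B \<and> f p \<in> fst c' then dir_deriv A (snd c' \<circ> f) p v else 0)"

type_synonym ('a, 'n) metric = "'a \<Rightarrow> ('a, 'n) tvec \<Rightarrow> ('a, 'n) tvec \<Rightarrow> real"

definition metric_coeff ::
    "('a, 'n::finite) chart set \<Rightarrow> ('a, 'n) metric \<Rightarrow> ('a, 'n) chart \<Rightarrow> real^'n \<Rightarrow> real^'n^'n" where
  "metric_coeff A g c y = (let x = chart_inv c y in
     \<chi> i j. g x (tvec_of A c x (axis i 1)) (tvec_of A c x (axis j 1)))"

definition riemannian_metric :: "('a, 'n::finite) chart set \<Rightarrow> ('a, 'n) metric \<Rightarrow> bool" where
  "riemannian_metric A g \<longleftrightarrow>
     (\<forall>x\<in>carrier A.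
        (\<forall>u\<in>tangent A x. \<forall>v\<in>tangent A x. g x u v = g x v u) \<and>
        (\<forall>u\<in>tangent A x. \<forall>v\<in>tangent A x. \<forall>w\<in>tangent A x. \<forall>a.
           g x (\<lambda>c. a *\<^sub>R u c + v c) w = a * g x u w + g x v w) \<and>
        (\<forall>u\<in>tangent A x. u \<noteq> (\<lambda>c. 0) \<longrightarrow> g x u u > 0)) \<and>
     (\<forall>c\<in>A. smooth_on (snd c ` fst c) (metric_coeff A g c))"

definition isometry ::
    "('a, 'n::finite) chart set \<Rightarrow> ('a, 'n) metric \<Rightarrow> ('b, 'n) chart set \<Rightarrow> ('b, 'n) metric \<Rightarrow>
     ('a \<Rightarrow> 'b) \<Rightarrow> bool" where
  "isometry A g B h f \<longleftrightarrow> diffeomorphism A B f \<and>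
     (\<forall>p\<in>carrier A. \<forall>u\<in>tangent A p. \<forall>v\<in>tangent A p.
        h (f p) (differential A B f p u) (differential A B f p v) = g p u v)"

text \<open>The group \<open>I(N, h)\<close>. Maps are only relevant on the carrier.\<close>

definition isometry_group :: "('a, 'n::finite) chart set \<Rightarrow> ('a, 'n) metric \<Rightarrow> ('a \<Rightarrow> 'a) set" where
  "isometry_group A g = {f. isometry A g A g f \<and> orientation_preserving A A f}"


section \<open>Levi-Civita connection and curvature in coordinates\<close>

definition pderiv_at :: "'n::finite \<Rightarrow> (real^'n \<Rightarrow> real) \<Rightarrow> real^'n \<Rightarrow> real" where
  "pderiv_at i f y = frechet_derivative f (at y) (axis i 1)"

text \<open>\<open>christoffel A g c y k i j\<close> is \<open>\<Gamma>\<^sup>k\<^sub>i\<^sub>j\<close>, and \<open>riemann_coeff A g c y l i j k\<close> is the \<open>l\<close>-th coordinate of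
  \<open>R(\<partial>\<^sub>i, \<partial>\<^sub>j)\<partial>\<^sub>k\<close>, where \<open>R(X, Y) = \<nabla>\<^sub>X\<nabla>\<^sub>Y - \<nabla>\<^sub>Y\<nabla>\<^sub>X - \<nabla>\<^sub>[\<^sub>X\<^sub>,\<^sub>Y\<^sub>]\<close>.\<close>

definition christoffel ::
    "('a, 'n::finite) chart set \<Rightarrow> ('a, 'n) metric \<Rightarrow> ('a, 'n) chart \<Rightarrow> real^'n \<Rightarrow>
     'n \<Rightarrow> 'n \<Rightarrow> 'n \<Rightarrow> real" where
  "christoffel A g c y k i j = (let G = metric_coeff A g c in
     (1/2) * (\<Sum>l\<in>UNIV. matrix_inv (G y) $ k $ l *
       (pderiv_at i (\<lambda>z. G z $ j $ l) y + pderiv_at j (\<lambda>z. G z $ i $ l) y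
        - pderiv_at l (\<lambda>z. G z $ i $ j) y)))"

definition riemann_coeff ::
    "('a, 'n::finite) chart set \<Rightarrow> ('a, 'n) metric \<Rightarrow> ('a, 'n) chart \<Rightarrow> real^'n \<Rightarrow>
     'n \<Rightarrow> 'n \<Rightarrow> 'n \<Rightarrow> 'n \<Rightarrow> real" where
  "riemann_coeff A g c y l i j k = (let \<Gamma> = christoffel A g c in
     pderiv_at i (\<lambda>z. \<Gamma> z l j k) y - pderiv_at j (\<lambda>z. \<Gamma> z l i k) y
     + (\<Sum>m\<in>UNIV. \<Gamma> y m j k * \<Gamma> y l i m - \<Gamma> y m i k * \<Gamma> y l j m))"

text \<open>\<open>K = g(R(\<partial>\<^sub>1, \<partial>\<^sub>2)\<partial>\<^sub>2, \<partial>\<^sub>1) / (g\<^sub>1\<^sub>1 g\<^sub>2\<^sub>2 - g\<^sub>1\<^sub>2\<^sup>2)\<close>, in any chart.\<close>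

definition gauss_curvature :: "('a, 2) chart set \<Rightarrow> ('a, 2) metric \<Rightarrow> 'a \<Rightarrow> real" where
  "gauss_curvature A g x = (let c = chart_at A x; y = snd c x; G = metric_coeff A g c y in
     (\<Sum>l\<in>UNIV. G $ 1 $ l * riemann_coeff A g c y l 1 2 2) / det G)"


section \<open>The bundle of positively oriented orthonormal frames\<close>

type_synonym 'a frame = "'a \<times> ('a, 2) tvec \<times> ('a, 2) tvec"

text \<open>\<open>SO_bundle A g\<close> is \<open>SO(M, g)\<close>, with projection \<open>\<pi>\<close> = \<^const>\<open>fst\<close>.\<close>

definition SO_bundle :: "('a, 2) chart set \<Rightarrow> ('a, 2) metric \<Rightarrow> 'a frame set" where
  "SO_bundle A g = {(x, e1, e2). x \<in> carrier A \<and> e1 \<in> tangent A x \<and> e2 \<in> tangent A x \<and>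
     g x e1 e1 = 1 \<and> g x e2 e2 = 1 \<and> g x e1 e2 = 0 \<and>
     (\<forall>c\<in>A. x \<in> fst c \<longrightarrow> det (vector [e1 c, e2 c] :: real^2^2) > 0)}"

definition frame_rot :: "'a frame \<Rightarrow> real \<Rightarrow> 'a frame" where
  "frame_rot p \<phi> = (case p of (x, e1, e2) \<Rightarrow>
     (x, (\<lambda>c. cos \<phi> *\<^sub>R e1 c + sin \<phi> *\<^sub>R e2 c), (\<lambda>c. - sin \<phi> *\<^sub>R e1 c + cos \<phi> *\<^sub>R e2 c)))"

text \<open>The frame at the point with coordinates \<open>y\<close> obtained by Gram--Schmidt orthonormalisation from
  the coordinate frame \<open>(\<partial>\<^sub>1, \<partial>\<^sub>2)\<close> of \<open>c\<close>.\<close>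

definition chart_frame ::
    "('a, 2) chart set \<Rightarrow> ('a, 2) metric \<Rightarrow> ('a, 2) chart \<Rightarrow> real^2 \<Rightarrow> 'a frame" where
  "chart_frame A g c y = (let x = chart_inv c y; G = metric_coeff A g c y in
     (x, tvec_of A c x ((1 / sqrt (G $ 1 $ 1)) *\<^sub>R vector [1, 0]),
         tvec_of A c x ((1 / sqrt (G $ 1 $ 1 * det G)) *\<^sub>R vector [- (G $ 1 $ 2), G $ 1 $ 1])))"

text \<open>The smooth structure of \<open>SO(M, g)\<close>: local coordinates of a frame \<open>(x, e1, e2)\<close> are the
  coordinates of \<open>x\<close> in an oriented chart \<open>c\<close> and the oriented angle from \<open>\<partial>\<^sub>1\<close> to \<open>e1\<close>, restricted to
  an interval \<open>(a, a + 2\<pi>)\<close>. This atlas is oriented.\<close>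

definition frame_param ::
    "('a, 2) chart set \<Rightarrow> ('a, 2) metric \<Rightarrow> ('a, 2) chart \<Rightarrow> real^3 \<Rightarrow> 'a frame" where
  "frame_param A g c z = frame_rot (chart_frame A g c (vector [z $ 1, z $ 2])) (z $ 3)"

definition SO_chart ::
    "('a, 2) chart set \<Rightarrow> ('a, 2) metric \<Rightarrow> ('a, 2) chart \<Rightarrow> real \<Rightarrow> ('a frame, 3) chart" where
  "SO_chart A g c a =
     (let \<Omega> = {z. vector [z $ 1, z $ 2] \<in> snd c ` fst c \<and> z $ 3 \<in> {a<..<a + 2 * pi}} in
      (frame_param A g c ` \<Omega>, inv_into \<Omega> (frame_param A g c)))"

definition SO_atlas :: "('a, 2) chart set \<Rightarrow> ('a, 2) metric \<Rightarrow> ('a frame, 3) chart set" where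
  "SO_atlas A g = {SO_chart A g c a | c a. c \<in> A}"

text \<open>The generator \<open>\<partial>\<^sub>\<phi>\<close> of the vertical distribution: the velocity at \<open>0\<close> of \<open>t \<mapsto> p \<cdot> r(t)\<close>.\<close>

definition vert_gen ::
    "('a, 2) chart set \<Rightarrow> ('a, 2) metric \<Rightarrow> 'a frame \<Rightarrow> ('a frame, 3) tvec" where
  "vert_gen A g p = (\<lambda>b. if b \<in> SO_atlas A g \<and> p \<in> fst b
     then vector_derivative (\<lambda>t. snd b (frame_rot p t)) (at 0) else 0)"

definition d_pi ::
    "('a, 2) chart set \<Rightarrow> ('a, 2) metric \<Rightarrow> 'a frame \<Rightarrow> ('a frame, 3) tvec \<Rightarrow> ('a, 2) tvec" where
  "d_pi A g = differential (SO_atlas A g) A fst"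

text \<open>The covariant derivative along \<open>X \<in> T\<^sub>p SO(M, g)\<close> of a vector field along \<open>\<pi>\<close>, i.e. of a map \<open>e\<close>
  assigning to each frame \<open>q\<close> a tangent vector at \<open>\<pi>(q)\<close>; in coordinates of \<open>M\<close>,
  \<open>(\<nabla>\<^sub>X e)\<^sup>k = X(e\<^sup>k) + \<Gamma>\<^sup>k\<^sub>i\<^sub>j (d\<pi> X)\<^sup>i e\<^sup>j\<close>.\<close>

definition cov_deriv ::
    "('a, 2) chart set \<Rightarrow> ('a, 2) metric \<Rightarrow> ('a frame \<Rightarrow> ('a, 2) tvec) \<Rightarrow> 'a frame \<Rightarrow>
     ('a frame, 3) tvec \<Rightarrow> real^2" where
  "cov_deriv A g e p X = (let c = chart_at A (fst p) in
     dir_deriv (SO_atlas A g) (\<lambda>q. e q c) p X +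
     (\<chi> k. \<Sum>i\<in>UNIV. \<Sum>j\<in>UNIV.
        christoffel A g c (snd c (fst p)) k i j * d_pi A g p X c $ i * e p c $ j))"

text \<open>\<open>\<H>\<^sub>p\<close> consists of the directions in which both vectors of the frame are parallel for the
  Levi-Civita connection, i.e. of the velocities of parallel frames along curves in \<open>M\<close>.\<close>

definition horizontal ::
    "('a, 2) chart set \<Rightarrow> ('a, 2) metric \<Rightarrow> 'a frame \<Rightarrow> ('a frame, 3) tvec set" where
  "horizontal A g p = {X \<in> tangent (SO_atlas A g) p.
     cov_deriv A g (\<lambda>q. fst (snd q)) p X = 0 \<and> cov_deriv A g (\<lambda>q. snd (snd q)) p X = 0}"

text \<open>The coefficient \<open>a\<close> in the decomposition \<open>X = H + a \<partial>\<^sub>\<phi>\<close> with \<open>H\<close> horizontal.\<close>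

definition vert_coeff ::
    "('a, 2) chart set \<Rightarrow> ('a, 2) metric \<Rightarrow> 'a frame \<Rightarrow> ('a frame, 3) tvec \<Rightarrow> real" where
  "vert_coeff A g p X = (THE a. (\<lambda>b. X b - a *\<^sub>R vert_gen A g p b) \<in> horizontal A g p)"

text \<open>On horizontal vectors \<^const>\<open>vert_coeff\<close> vanishes; on \<open>\<partial>\<^sub>\<phi>\<close> the differential of \<open>\<pi>\<close> vanishes and
  \<^const>\<open>vert_coeff\<close> is \<open>1\<close>. So this is the bilinear form which is \<open>\<pi>\<^sup>*g\<close> on \<open>\<H>\<close>, has \<open>\<H> \<bottom> V\<close>, and takes
  the value \<open>1/K\<^sup>2\<close> on \<open>(\<partial>\<^sub>\<phi>, \<partial>\<^sub>\<phi>)\<close>.\<close>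

definition wagner_lift :: "('a, 2) chart set \<Rightarrow> ('a, 2) metric \<Rightarrow> ('a frame, 3) metric" where
  "wagner_lift A g p X Y =
     g (fst p) (d_pi A g p X) (d_pi A g p Y) +
     vert_coeff A g p X * vert_coeff A g p Y / (gauss_curvature A g (fst p))\<^sup>2"


section \<open>Projectable isometries\<close>

definition projects_to ::
    "('a, 2) chart set \<Rightarrow> ('a, 2) metric \<Rightarrow> ('a frame \<Rightarrow> 'a frame) \<Rightarrow> ('a \<Rightarrow> 'a) \<Rightarrow> bool" where
  "projects_to A g fh f \<longleftrightarrow> diffeomorphism A A f \<and> (\<forall>p\<in>SO_bundle A g. fst (fh p) = f (fst p))"

definition projectable ::
    "('a, 2) chart set \<Rightarrow> ('a, 2) metric \<Rightarrow> ('a frame \<Rightarrow> 'a frame) \<Rightarrow> bool" where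
  "projectable A g fh \<longleftrightarrow> diffeomorphism (SO_atlas A g) (SO_atlas A g) fh \<and> (\<exists>f. projects_to A g fh f)"

text \<open>\<open>\<pi>\<^sub>*(fh)\<close>; the choice is unique on the carrier, since \<open>\<pi>\<close> is onto.\<close>

definition pi_push ::
    "('a, 2) chart set \<Rightarrow> ('a, 2) metric \<Rightarrow> ('a frame \<Rightarrow> 'a frame) \<Rightarrow> 'a \<Rightarrow> 'a" where
  "pi_push A g fh = (SOME f. projects_to A g fh f)"

definition fibre_orientation_preserving ::
    "('a, 2) chart set \<Rightarrow> ('a, 2) metric \<Rightarrow> ('a frame \<Rightarrow> 'a frame) \<Rightarrow> bool" where
  "fibre_orientation_preserving A g fh \<longleftrightarrow> (\<forall>p\<in>SO_bundle A g. \<exists>t>0.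
     differential (SO_atlas A g) (SO_atlas A g) fh p (vert_gen A g p) =
       (\<lambda>b. t *\<^sub>R vert_gen A g (fh p) b))"

text \<open>All projectable isometries of the Wagner lift, with no condition on orientations.\<close>

definition all_projectable_isometries ::
    "('a, 2) chart set \<Rightarrow> ('a, 2) metric \<Rightarrow> ('a frame \<Rightarrow> 'a frame) set" where
  "all_projectable_isometries A g = {fh. projectable A g fh \<and>
     isometry (SO_atlas A g) (wagner_lift A g) (SO_atlas A g) (wagner_lift A g) fh}"

text \<open>The group \<open>I\<^sub>p\<close> of the Wagner lift. Preserving orientation is understood for \<open>SO(M, g)\<close> as an oriented
  bundle: both the orientation of the total space and that of the fibres (given by \<open>\<partial>\<^sub>\<phi>\<close>) are
  preserved. The former alone would allow the map \<open>(e1, e2) \<mapsto> (df e1, - df e2)\<close> induced by an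
  orientation-reversing isometry \<open>f\<close> of \<open>(M, g)\<close>, which is a projectable isometry preserving the
  orientation of the total space.\<close>

definition projectable_isometry_group ::
    "('a, 2) chart set \<Rightarrow> ('a, 2) metric \<Rightarrow> ('a frame \<Rightarrow> 'a frame) set" where
  "projectable_isometry_group A g =
     {fh \<in> isometry_group (SO_atlas A g) (wagner_lift A g).
        projectable A g fh \<and> fibre_orientation_preserving A g fh}"

definition oriented_riemannian_surface ::
    "'a topology \<Rightarrow> ('a, 2) chart set \<Rightarrow> ('a, 2) metric \<Rightarrow> bool" where
  "oriented_riemannian_surface X A g \<longleftrightarrow> oriented_manifold X A \<and> riemannian_metric A g"

end

theory Submission
  imports Defs
begin

text \<open>Since \<open>\<pi> \<circ> fh = f \<circ> \<pi>\<close>, the differentials satisfy \<open>d\<pi> \<circ> dfh = df \<circ> d\<pi>\<close>. The Wagner lift satisfies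
  \<open>\<pi>\<^sup>*g \<le> wagner_lift\<close> as quadratic forms, with equality on horizontal vectors. If \<open>Y\<close> is a horizontal lift
  of \<open>u\<close>, this gives \<open>g(df u, df u) \<le> g(u, u)\<close>; lifting \<open>df u\<close> horizontally instead and applying the
  inverse of \<open>dfh\<close> gives the opposite inequality, and polarisation concludes. Horizontal lifts exist because
  the Christoffel symbols are compatible with \<open>g\<close>, so that both vectors of an orthonormal frame can
  be made parallel by correcting with a multiple of \<open>\<partial>\<^sub>\<phi>\<close>. In bundle charts the Jacobian matrix of \<open>fh\<close> is
  block triangular with diagonal blocks \<open>df\<close> and \<open>t > 0\<close>, whence the statement on orientations.\<close>

section \<open>Differentials in charts\<close>

text \<open>The inequality argument avoids proving that the differential of \<open>fh\<close> maps
  horizontal vectors to horizontal ones: a lift of u at q and a lift of df u at \<open>fh q\<close>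
  are chosen independently, and each is compared with a vector of which only the projection is
  known. Two features of the encoding shape the rest. First, \<open>chart_inv\<close> is an
  \<open>inv_into\<close> with arbitrary values off the image of its chart, and maps matter only on
  the carrier, so identities between coordinate representations hold only near a point; hence the
  calculus with \<open>nhds\<close>. Second, \<open>cov_deriv\<close> uses the chart
  \<open>chart_at A (fst q)\<close>, while the bundle chart \<open>chart_at SO q\<close> may be
  built from another chart of the surface, so frames have to be differentiated through a transition
  map. Metric compatibility enters as skewness: differentiating the orthonormality relations leaves
  a single connection form with value 1 on the vertical generator, and its value on a vector is the
  multiple of the generator to subtract. For orientations, the total space controls only the sign of
  t * det(df); the fibre condition supplies t > 0.\<close>

lemma has_derivative_transform_nhds:
  assumes "(f has_derivative f') (at x)" and ev: "\<forall>\<^sub>F z in nhds x. f z = h z"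
  shows "(h has_derivative f') (at x)"
  by (rule has_derivative_transform_eventually[OF assms(1)])
    (use ev eventually_nhds_x_imp_x[OF ev] in \<open>auto simp: eventually_at_filter elim: eventually_mono\<close>)

lemma frechet_derivative_cong_nhds:
  assumes "\<forall>\<^sub>F z in nhds x. f z = h z"
  shows "frechet_derivative f (at x) = frechet_derivative h (at x)"
proof -
  have "\<forall>\<^sub>F z in nhds x. h z = f z" using assms by eventually_elim simp
  then have "(f has_derivative D) (at x) \<longleftrightarrow> (h has_derivative D) (at x)" for D
    using has_derivative_transform_nhds assms by blast
  then show ?thesis by (simp add: frechet_derivative_def)
qed

lemma nth_has_derivative:
  fixes f :: "'a::real_normed_vector \<Rightarrow> 'b::real_normed_vector ^ 'n::finite"
  assumes "(f has_derivative f') F"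
  shows "((\<lambda>x. f x $ i) has_derivative (\<lambda>x. f' x $ i)) F"
  using bounded_linear.has_derivative[OF bounded_linear_vec_nth assms] .

lemma nth_differentiable:
  fixes f :: "'a::real_normed_vector \<Rightarrow> 'b::real_normed_vector ^ 'n::finite"
  shows "f differentiable F \<Longrightarrow> (\<lambda>x. f x $ i) differentiable F"
  using nth_has_derivative unfolding differentiable_def by blast

lemma smooth_on_differentiable:
  assumes "smooth_on S f" "x \<in> S"
  shows "f differentiable (at x)"
proof -
  have "Ck_on (Suc 0) S f"
    using assms(1) unfolding smooth_on_def by blast
  then show ?thesis using assms(2) by simp
qed

lemma smooth_on_deriv_differentiable:
  assumes "smooth_on S f" "x \<in> S"
  shows "(\<lambda>y. frechet_derivative f (at y) v) differentiable (at x)"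
proof -
  have "Ck_on (Suc (Suc 0)) S f"
    using assms(1) unfolding smooth_on_def by blast
  then show ?thesis using assms(2) by simp
qed

section \<open>Coordinate representations and the chain rule\<close>

definition chart_deriv ::
    "('a, 'n::finite) chart \<Rightarrow> ('b, 'm::finite) chart \<Rightarrow> ('a \<Rightarrow> 'b) \<Rightarrow> 'a \<Rightarrow> real^'n \<Rightarrow> real^'m" where
  "chart_deriv c c' f x = frechet_derivative (snd c' \<circ> f \<circ> chart_inv c) (at (snd c x))"

text \<open>A first-order, pointwise weakening of \<open>smooth_map\<close>, closed under
  composition. The neighbourhood clause stands for continuity: it keeps \<open>chart_inv c z\<close>
  and its image inside the chart domains, where the coordinate maps and their inverses are
  meaningful.\<close>

definition differentiable_map_at ::
    "('a, 'n::finite) chart set \<Rightarrow> ('b, 'm::finite) chart set \<Rightarrow> ('a \<Rightarrow> 'b) \<Rightarrow> 'a \<Rightarrow> bool" where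
  "differentiable_map_at A B f x \<longleftrightarrow> x \<in> carrier A \<and> f x \<in> carrier B \<and>
     (\<forall>c\<in>A. \<forall>c'\<in>B. x \<in> fst c \<longrightarrow> f x \<in> fst c' \<longrightarrow>
        (\<forall>\<^sub>F z in nhds (snd c x). z \<in> snd c ` fst c \<and> f (chart_inv c z) \<in> fst c') \<and>
        (snd c' \<circ> f \<circ> chart_inv c) differentiable (at (snd c x)))"

text \<open>Just enough structure for tangent vectors and differentials to be chart independent. It
  is weaker than a smooth atlas so that it can be obtained for \<open>SO_atlas\<close> without
  computing transition maps.\<close>

definition differentiable_atlas :: "('a, 'n::finite) chart set \<Rightarrow> bool" where
  "differentiable_atlas A \<longleftrightarrow> (\<forall>c\<in>A. inj_on (snd c) (fst c)) \<and>
     (\<forall>x\<in>carrier A. differentiable_map_at A A (\<lambda>x. x) x)"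

lemma carrierI: "c \<in> A \<Longrightarrow> x \<in> fst c \<Longrightarrow> x \<in> carrier A"
  by (auto simp: carrier_def)

lemma chart_at:
  assumes "x \<in> carrier A"
  shows "chart_at A x \<in> A" "x \<in> fst (chart_at A x)"
proof -
  have "\<exists>c. c \<in> A \<and> x \<in> fst c" using assms by (auto simp: carrier_def)
  from someI_ex[OF this] show "chart_at A x \<in> A" "x \<in> fst (chart_at A x)"
    by (auto simp: chart_at_def)
qed

lemma chart_inv_chart: "inj_on (snd c) (fst c) \<Longrightarrow> x \<in> fst c \<Longrightarrow> chart_inv c (snd c x) = x"
  by (simp add: chart_inv_def)

lemma chart_inv_in: "y \<in> snd c ` fst c \<Longrightarrow> chart_inv c y \<in> fst c"
  by (simp add: chart_inv_def inv_into_into)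

lemma chart_chart_inv: "y \<in> snd c ` fst c \<Longrightarrow> snd c (chart_inv c y) = y"
  by (simp add: chart_inv_def f_inv_into_f)

lemma chart_has_derivative:
  assumes "differentiable_map_at A B f x" "c \<in> A" "c' \<in> B" "x \<in> fst c" "f x \<in> fst c'"
  shows "((snd c' \<circ> f \<circ> chart_inv c) has_derivative chart_deriv c c' f x) (at (snd c x))"
  using assms frechet_derivative_works unfolding differentiable_map_at_def chart_deriv_def by blast

lemma chart_eventually:
  assumes "differentiable_map_at A B f x" "c \<in> A" "c' \<in> B" "x \<in> fst c" "f x \<in> fst c'"
  shows "\<forall>\<^sub>F z in nhds (snd c x). z \<in> snd c ` fst c \<and> f (chart_inv c z) \<in> fst c'"
  using assms unfolding differentiable_map_at_def by blast

lemma linear_chart_deriv: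
  assumes "differentiable_map_at A B f x" "c \<in> A" "c' \<in> B" "x \<in> fst c" "f x \<in> fst c'"
  shows "linear (chart_deriv c c' f x)"
  using chart_has_derivative[OF assms] has_derivative_linear by blast

text \<open>Inserting \<open>chart_inv c'\<close> after \<open>snd c'\<close> is harmless only where
  f lands in the domain of c'. Differentiability makes the representation of f continuous, so this
  holds near \<open>snd c x\<close>, which suffices for the derivative.\<close>

lemma chart_comp:
  assumes inj: "inj_on (snd c) (fst c)" "inj_on (snd c') (fst c')"
    and f: "differentiable_map_at A B f x" and h: "differentiable_map_at B C h (f x)"
    and c: "c \<in> A" "c' \<in> B" "c'' \<in> C" "x \<in> fst c" "f x \<in> fst c'" "h (f x) \<in> fst c''"
  shows "((snd c'' \<circ> (h \<circ> f) \<circ> chart_inv c) has_derivative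
           (chart_deriv c' c'' h (f x) \<circ> chart_deriv c c' f x)) (at (snd c x))" (is ?D)
    and "\<forall>\<^sub>F z in nhds (snd c x). z \<in> snd c ` fst c \<and> (h \<circ> f) (chart_inv c z) \<in> fst c''" (is ?E)
proof -
  let ?f = "snd c' \<circ> f \<circ> chart_inv c" and ?h = "snd c'' \<circ> h \<circ> chart_inv c'"
  have 0: "?f (snd c x) = snd c' (f x)"
    using inj c by (simp add: chart_inv_chart)
  have df: "(?f has_derivative chart_deriv c c' f x) (at (snd c x))"
    by (rule chart_has_derivative[OF f]) (use c in auto)
  have "(?h has_derivative chart_deriv c' c'' h (f x)) (at (snd c' (f x)))"
    by (rule chart_has_derivative[OF h]) (use c in auto)
  then have "(?h has_derivative chart_deriv c' c'' h (f x)) (at (?f (snd c x)))"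
    unfolding 0 .
  note D = diff_chain_at[OF df this]
  have e1: "\<forall>\<^sub>F z in nhds (snd c x). z \<in> snd c ` fst c \<and> f (chart_inv c z) \<in> fst c'"
    by (rule chart_eventually[OF f]) (use c in auto)
  have e2: "\<forall>\<^sub>F z in nhds (snd c' (f x)). z \<in> snd c' ` fst c' \<and> h (chart_inv c' z) \<in> fst c''"
    by (rule chart_eventually[OF h]) (use c in auto)
  have eq: "chart_inv c' (?f z) = f (chart_inv c z)" if "f (chart_inv c z) \<in> fst c'" for z
    using that inj by (simp add: chart_inv_chart)
  have "isCont ?f (snd c x)" using df by (rule has_derivative_continuous)
  then have "filterlim ?f (nhds (snd c' (f x))) (nhds (snd c x))"
    using 0 by (metis isCont_def tendsto_at_iff_tendsto_nhds)
  then have "\<forall>\<^sub>F z in nhds (snd c x). ?f z \<in> snd c' ` fst c' \<and> h (chart_inv c' (?f z)) \<in> fst c''"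
    using e2 unfolding filterlim_iff by blast
  then show ?E
    using e1 by eventually_elim (use eq in auto)
  have ev: "\<forall>\<^sub>F z in nhds (snd c x). (?h \<circ> ?f) z = (snd c'' \<circ> (h \<circ> f) \<circ> chart_inv c) z"
    using e1 by eventually_elim (use eq in auto)
  show ?D
    by (rule has_derivative_transform_nhds[OF D ev])
qed

lemma chart_deriv_comp:
  assumes "inj_on (snd c) (fst c)" "inj_on (snd c') (fst c')"
    and "differentiable_map_at A B f x" "differentiable_map_at B C h (f x)"
    and "c \<in> A" "c' \<in> B" "c'' \<in> C" "x \<in> fst c" "f x \<in> fst c'" "h (f x) \<in> fst c''"
  shows "chart_deriv c c'' (h \<circ> f) x w = chart_deriv c' c'' h (f x) (chart_deriv c c' f x w)"
  using frechet_derivative_at[OF chart_comp(1)[OF assms]]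
  by (simp add: chart_deriv_def[of c c''] fun_eq_iff)

lemma differentiable_map_at_comp:
  assumes inj: "\<forall>c\<in>A. inj_on (snd c) (fst c)" "\<forall>c\<in>B. inj_on (snd c) (fst c)"
    and f: "differentiable_map_at A B f x" and h: "differentiable_map_at B C h (f x)"
  shows "differentiable_map_at A C (h \<circ> f) x"
proof -
  have "f x \<in> carrier B" using f by (simp add: differentiable_map_at_def)
  then obtain c' where c': "c' \<in> B" "f x \<in> fst c'" by (auto simp: carrier_def)
  show ?thesis
    unfolding differentiable_map_at_def
  proof (intro conjI ballI impI)
    show "x \<in> carrier A" "(h \<circ> f) x \<in> carrier C"
      using f h by (auto simp: differentiable_map_at_def)
    fix c c'' assume c: "c \<in> A" "c'' \<in> C" "x \<in> fst c" "(h \<circ> f) x \<in> fst c''"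
    note * = chart_comp[of c c' A B f x C h c'']
    have "(snd c'' \<circ> (h \<circ> f) \<circ> chart_inv c has_derivative
           (chart_deriv c' c'' h (f x) \<circ> chart_deriv c c' f x)) (at (snd c x))"
      by (rule *(1)) (use inj f h c c' in auto)
    then show "snd c'' \<circ> (h \<circ> f) \<circ> chart_inv c differentiable at (snd c x)"
      by (rule differentiableI)
    have "\<forall>\<^sub>F z in nhds (snd c x). z \<in> snd c ` fst c \<and> (h \<circ> f) (chart_inv c z) \<in> fst c''"
      by (rule *(2)) (use inj f h c c' in auto)
    then show "\<forall>\<^sub>F z in nhds (snd c x). z \<in> snd c ` fst c \<and> (h \<circ> f) (chart_inv c z) \<in> fst c''" .
  qed
qed

text \<open>Agreement on the carrier is enough: for z near \<open>snd c x\<close> the point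
  \<open>chart_inv c z\<close> lies in the domain of c, hence in the carrier.\<close>

lemma chart_rep_cong:
  assumes f: "differentiable_map_at A B f x" and eq: "\<And>y. y \<in> carrier A \<Longrightarrow> f y = f' y"
    and c: "c \<in> A" "c' \<in> B" "x \<in> fst c" "f x \<in> fst c'"
  shows "((snd c' \<circ> f' \<circ> chart_inv c) has_derivative chart_deriv c c' f x) (at (snd c x))"
proof -
  have e: "\<forall>\<^sub>F z in nhds (snd c x). (snd c' \<circ> f \<circ> chart_inv c) z = (snd c' \<circ> f' \<circ> chart_inv c) z"
    using chart_eventually[OF f c]
    by eventually_elim (use eq carrierI[OF c(1) chart_inv_in] in auto)
  show ?thesis
    by (rule has_derivative_transform_nhds[OF chart_has_derivative[OF f c] e])
qed

lemma chart_deriv_cong: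
  assumes "differentiable_map_at A B f x" "\<And>y. y \<in> carrier A \<Longrightarrow> f y = f' y"
    and "c \<in> A" "c' \<in> B" "x \<in> fst c" "f x \<in> fst c'"
  shows "chart_deriv c c' f' x = chart_deriv c c' f x"
  using frechet_derivative_at[OF chart_rep_cong[OF assms]] by (simp add: chart_deriv_def)

lemma differentiable_map_at_cong:
  assumes f: "differentiable_map_at A B f x" and eq: "\<And>y. y \<in> carrier A \<Longrightarrow> f y = f' y"
  shows "differentiable_map_at A B f' x"
  unfolding differentiable_map_at_def
proof (intro conjI ballI impI)
  have x: "x \<in> carrier A" using f by (simp add: differentiable_map_at_def)
  then have fx: "f' x = f x" using eq by simp
  show "x \<in> carrier A" "f' x \<in> carrier B"
    using f fx by (auto simp: differentiable_map_at_def)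
  fix c c' assume c: "c \<in> A" "c' \<in> B" "x \<in> fst c" "f' x \<in> fst c'"
  then show "snd c' \<circ> f' \<circ> chart_inv c differentiable at (snd c x)"
    using differentiableI[OF chart_rep_cong[OF f eq]] fx by simp
  have *: "\<forall>\<^sub>F z in nhds (snd c x). z \<in> snd c ` fst c \<and> f (chart_inv c z) \<in> fst c'"
    by (rule chart_eventually[OF f]) (use c fx in auto)
  show "\<forall>\<^sub>F z in nhds (snd c x). z \<in> snd c ` fst c \<and> f' (chart_inv c z) \<in> fst c'"
    using * by eventually_elim (use eq carrierI[OF c(1) chart_inv_in] in auto)
qed

text \<open>The openness of \<open>?W\<close>, which is the continuity clause of
  \<open>smooth_map\<close>, supplies the neighbourhood condition.\<close>

lemma smooth_map_differentiable:
  assumes f: "smooth_map A B f" and x: "x \<in> carrier A" and inj: "\<forall>c\<in>A. inj_on (snd c) (fst c)"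
  shows "differentiable_map_at A B f x"
  unfolding differentiable_map_at_def
proof (intro conjI ballI impI)
  show "x \<in> carrier A" "f x \<in> carrier B" using f x by (auto simp: smooth_map_def)
  fix c c' assume c: "c \<in> A" "c' \<in> B" "x \<in> fst c" "f x \<in> fst c'"
  let ?W = "snd c ` (fst c \<inter> f -` fst c')"
  have W: "open ?W" "smooth_on ?W (snd c' \<circ> f \<circ> chart_inv c)" "snd c x \<in> ?W"
    using f c by (auto simp: smooth_map_def Let_def)
  show "snd c' \<circ> f \<circ> chart_inv c differentiable at (snd c x)"
    using smooth_on_differentiable[OF W(2,3)] .
  have e: "\<forall>\<^sub>F z in nhds (snd c x). z \<in> ?W"
    using W eventually_nhds by blast
  then show "\<forall>\<^sub>F z in nhds (snd c x). z \<in> snd c ` fst c \<and> f (chart_inv c z) \<in> fst c'"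
    by eventually_elim (use inj c in \<open>auto simp: chart_inv_chart\<close>)
qed

lemma diffeomorphism_differentiable:
  assumes "diffeomorphism A B f" "\<forall>c\<in>A. inj_on (snd c) (fst c)" "\<forall>c\<in>B. inj_on (snd c) (fst c)"
  shows "x \<in> carrier A \<Longrightarrow> differentiable_map_at A B f x"
    and "y \<in> carrier B \<Longrightarrow> differentiable_map_at B A (inv_into (carrier A) f) y"
  using assms by (auto simp: diffeomorphism_def intro: smooth_map_differentiable)

lemma diffeomorphism_inv:
  assumes "diffeomorphism A B f"
  shows "x \<in> carrier A \<Longrightarrow> f x \<in> carrier B"
    and "x \<in> carrier A \<Longrightarrow> inv_into (carrier A) f (f x) = x"
    and "y \<in> carrier B \<Longrightarrow> inv_into (carrier A) f y \<in> carrier A"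
    and "y \<in> carrier B \<Longrightarrow> f (inv_into (carrier A) f y) = y"
  using assms by (auto simp: diffeomorphism_def bij_betw_def inv_into_into f_inv_into_f)

text \<open>The transition maps are the coordinate representations of the identity, which is the composition
  of \<open>f\<close> and its inverse. This avoids computing the transition maps of \<^const>\<open>SO_atlas\<close>.\<close>

lemma diffeomorphism_imp_differentiable_atlas:
  assumes f: "diffeomorphism A B f"
    and inj: "\<forall>c\<in>A. inj_on (snd c) (fst c)" "\<forall>c\<in>B. inj_on (snd c) (fst c)"
  shows "differentiable_atlas A"
  unfolding differentiable_atlas_def
proof (intro conjI ballI)
  fix x assume x: "x \<in> carrier A"
  have "differentiable_map_at A A (inv_into (carrier A) f \<circ> f) x"
    by (rule differentiable_map_at_comp[OF inj])
      (use diffeomorphism_differentiable[OF f inj] diffeomorphism_inv[OF f] x in auto)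
  then show "differentiable_map_at A A (\<lambda>x. x) x"
    by (rule differentiable_map_at_cong) (use diffeomorphism_inv[OF f] in auto)
qed (use inj in auto)

lemma
  assumes "differentiable_atlas A"
  shows differentiable_atlas_inj: "c \<in> A \<Longrightarrow> inj_on (snd c) (fst c)"
    and differentiable_atlas_id: "x \<in> carrier A \<Longrightarrow> differentiable_map_at A A (\<lambda>x. x) x"
  using assms by (auto simp: differentiable_atlas_def)

section \<open>Tangent vectors and differentials\<close>

lemma tangentD:
  assumes "u \<in> tangent A x" "c \<in> A" "c' \<in> A" "x \<in> fst c" "x \<in> fst c'"
  shows "u c' = chart_deriv c c' (\<lambda>x. x) x (u c)"
  using assms unfolding tangent_def chart_deriv_def o_def mem_Collect_eq by blast

lemma tangentI:
  assumes "\<And>c c'. c \<in> A \<Longrightarrow> c' \<in> A \<Longrightarrow> x \<in> fst c \<Longrightarrow> x \<in> fst c' \<Longrightarrow>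
      u c' = chart_deriv c c' (\<lambda>x. x) x (u c)"
    and "\<And>c. \<not> (c \<in> A \<and> x \<in> fst c) \<Longrightarrow> u c = 0"
  shows "u \<in> tangent A x"
  using assms unfolding tangent_def chart_deriv_def o_def mem_Collect_eq by blast

text \<open>The transformation law propagates one coordinate vector to all charts around x, and the
  value is 0 at the remaining charts.\<close>

lemma tangent_eqI:
  assumes u: "u \<in> tangent A x" and v: "v \<in> tangent A x"
    and c: "c \<in> A" "x \<in> fst c" "u c = v c"
  shows "u = v"
proof
  fix c'
  show "u c' = v c'"
  proof (cases "c' \<in> A \<and> x \<in> fst c'")
    case True
    then show ?thesis using tangentD[OF u, of c c'] tangentD[OF v, of c c'] c by simp
  next
    case False
    then have "u c' = 0" "v c' = 0" using u v unfolding tangent_def by blast+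
    then show ?thesis by simp
  qed
qed

lemma tvec_of_eq:
  "c' \<in> A \<Longrightarrow> x \<in> fst c' \<Longrightarrow> tvec_of A c x w c' = chart_deriv c c' (\<lambda>x. x) x w"
  by (simp add: tvec_of_def chart_deriv_def o_def)

lemma tvec_of_self:
  assumes A: "differentiable_atlas A" and c: "c \<in> A" "x \<in> fst c"
  shows "tvec_of A c x w c = w"
proof -
  have id: "differentiable_map_at A A (\<lambda>x. x) x"
    using A c differentiable_atlas_id carrierI by metis
  have ev: "\<forall>\<^sub>F z in nhds (snd c x). (\<lambda>z. z) z = (snd c \<circ> (\<lambda>x. x) \<circ> chart_inv c) z"
    using chart_eventually[OF id c(1) c(1) c(2) c(2)]
    by eventually_elim (auto simp: chart_chart_inv)
  have "((snd c \<circ> (\<lambda>x. x) \<circ> chart_inv c) has_derivative (\<lambda>z. z)) (at (snd c x))"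
    by (rule has_derivative_transform_nhds[OF has_derivative_ident ev])
  from frechet_derivative_at[OF this] c show ?thesis
    by (simp add: tvec_of_eq chart_deriv_def fun_eq_iff)
qed

lemma tvec_of_tangent:
  assumes A: "differentiable_atlas A" and c: "c \<in> A" "x \<in> fst c"
  shows "tvec_of A c x w \<in> tangent A x"
proof -
  have id: "differentiable_map_at A A (\<lambda>x. x) x"
    using A c differentiable_atlas_id carrierI by metis
  show ?thesis
  proof (rule tangentI)
    fix c' c'' assume c': "c' \<in> A" "c'' \<in> A" "x \<in> fst c'" "x \<in> fst c''"
    show "tvec_of A c x w c'' = chart_deriv c' c'' (\<lambda>x. x) x (tvec_of A c x w c')"
      using chart_deriv_comp[OF differentiable_atlas_inj[OF A c(1)] differentiable_atlas_inj[OF A c'(1)]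
          id id c(1) c'(1,2) c(2) c'(3,4), of w] c'
      by (simp add: tvec_of_eq o_def)
  qed (simp only: tvec_of_def if_False)
qed

lemma tangent_lincomb:
  assumes A: "differentiable_atlas A" and x: "x \<in> carrier A"
    and u: "u \<in> tangent A x" and v: "v \<in> tangent A x"
  shows "(\<lambda>c. a *\<^sub>R u c + b *\<^sub>R v c) \<in> tangent A x"
proof (rule tangentI)
  fix c c' assume c: "c \<in> A" "c' \<in> A" "x \<in> fst c" "x \<in> fst c'"
  have "linear (chart_deriv c c' (\<lambda>x. x) x)"
    using linear_chart_deriv[OF differentiable_atlas_id[OF A x]] c by simp
  then show "a *\<^sub>R u c' + b *\<^sub>R v c' = chart_deriv c c' (\<lambda>x. x) x (a *\<^sub>R u c + b *\<^sub>R v c)"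
    using tangentD[OF u c] tangentD[OF v c] by (simp add: linear_add linear_scale)
next
  fix c assume "\<not> (c \<in> A \<and> x \<in> fst c)"
  then have "u c = 0" "v c = 0" using u v unfolding tangent_def by blast+
  then show "a *\<^sub>R u c + b *\<^sub>R v c = 0" by simp
qed

lemma zero_tangent:
  assumes A: "differentiable_atlas A" and x: "x \<in> carrier A"
  shows "(\<lambda>c. 0) \<in> tangent A x"
  using tangent_lincomb[OF A x, of "tvec_of A (chart_at A x) x 0" "tvec_of A (chart_at A x) x 0" 0 0]
    tvec_of_tangent[OF A chart_at[OF x]] by simp

text \<open>\<open>differential\<close> is computed in the chosen chart \<open>chart_at A x\<close>.
  Factoring f as f after the identity through that chart, the chain rule and the transformation law
  of u carry the formula over to any chart c.\<close>

lemma differential_eq: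
  assumes A: "differentiable_atlas A" and f: "differentiable_map_at A B f x"
    and u: "u \<in> tangent A x" and c: "c \<in> A" "c' \<in> B" "x \<in> fst c" "f x \<in> fst c'"
  shows "differential A B f x u c' = chart_deriv c c' f x (u c)"
proof -
  have x: "x \<in> carrier A" using c by (auto intro: carrierI)
  note ca = chart_at[OF x]
  have "chart_deriv c c' (f \<circ> (\<lambda>x. x)) x (u c) =
      chart_deriv (chart_at A x) c' f x (chart_deriv c (chart_at A x) (\<lambda>x. x) x (u c))"
    by (rule chart_deriv_comp[OF differentiable_atlas_inj[OF A] differentiable_atlas_inj[OF A]
      differentiable_atlas_id[OF A x]]) (use f c ca in auto)
  also have "chart_deriv c (chart_at A x) (\<lambda>x. x) x (u c) = u (chart_at A x)"
    using tangentD[OF u, of c "chart_at A x"] c ca by simp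
  finally show ?thesis
    using c by (simp add: differential_def dir_deriv_def chart_deriv_def Let_def o_def)
qed

lemma differential_outside: "\<not> (c' \<in> B \<and> f x \<in> fst c') \<Longrightarrow> differential A B f x u c' = 0"
  by (simp only: differential_def if_False)

text \<open>The transformation law of the image is the chain rule for the identity after f.\<close>

lemma differential_tangent:
  assumes A: "differentiable_atlas A" and B: "differentiable_atlas B"
    and f: "differentiable_map_at A B f x" and u: "u \<in> tangent A x"
  shows "differential A B f x u \<in> tangent B (f x)"
proof -
  have x: "x \<in> carrier A" and fx: "f x \<in> carrier B"
    using f by (auto simp: differentiable_map_at_def)
  note ca = chart_at[OF x]
  show ?thesis
  proof (rule tangentI)
    fix c' c'' assume c: "c' \<in> B" "c'' \<in> B" "f x \<in> fst c'" "f x \<in> fst c''"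
    have "chart_deriv (chart_at A x) c'' ((\<lambda>x. x) \<circ> f) x (u (chart_at A x)) =
      chart_deriv c' c'' (\<lambda>x. x) (f x) (chart_deriv (chart_at A x) c' f x (u (chart_at A x)))"
      by (rule chart_deriv_comp[OF differentiable_atlas_inj[OF A] differentiable_atlas_inj[OF B] f
        differentiable_atlas_id[OF B fx]]) (use c ca in auto)
    then show "differential A B f x u c'' = chart_deriv c' c'' (\<lambda>x. x) (f x) (differential A B f x u c')"
      using differential_eq[OF A f u ca(1) _ ca(2)] c by (simp add: o_def)
  qed (rule differential_outside)
qed

lemma differential_comp:
  assumes A: "differentiable_atlas A" and B: "differentiable_atlas B"
    and f: "differentiable_map_at A B f x" and h: "differentiable_map_at B C h (f x)"
    and u: "u \<in> tangent A x"
  shows "differential B C h (f x) (differential A B f x u) = differential A C (h \<circ> f) x u"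
proof
  fix c''
  have x: "x \<in> carrier A" and fx: "f x \<in> carrier B"
    using f by (auto simp: differentiable_map_at_def)
  note ca = chart_at[OF x] and cb = chart_at[OF fx]
  show "differential B C h (f x) (differential A B f x u) c'' = differential A C (h \<circ> f) x u c''"
  proof (cases "c'' \<in> C \<and> h (f x) \<in> fst c''")
    case True
    have hf: "differentiable_map_at A C (h \<circ> f) x"
      using differentiable_map_at_comp[OF _ _ f h] A B by (auto simp: differentiable_atlas_def)
    have "differential B C h (f x) (differential A B f x u) c'' =
       chart_deriv (chart_at B (f x)) c'' h (f x) (differential A B f x u (chart_at B (f x)))"
      by (rule differential_eq[OF B h differential_tangent[OF A B f u]]) (use True cb in auto)
    also have "\<dots> = chart_deriv (chart_at B (f x)) c'' h (f x)
        (chart_deriv (chart_at A x) (chart_at B (f x)) f x (u (chart_at A x)))"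
      using differential_eq[OF A f u, of "chart_at A x" "chart_at B (f x)"] ca cb by simp
    also have "\<dots> = chart_deriv (chart_at A x) c'' (h \<circ> f) x (u (chart_at A x))"
      by (rule chart_deriv_comp[OF differentiable_atlas_inj[OF A] differentiable_atlas_inj[OF B] f h,
        symmetric]) (use ca cb True in auto)
    also have "\<dots> = differential A C (h \<circ> f) x u c''"
      by (rule differential_eq[OF A hf u, symmetric]) (use True ca in auto)
    finally show ?thesis .
  next
    case False
    then show ?thesis by (simp only: differential_outside o_apply not_False_eq_True)
  qed
qed

lemma differential_cong:
  assumes A: "differentiable_atlas A" and f: "differentiable_map_at A B f x"
    and eq: "\<And>y. y \<in> carrier A \<Longrightarrow> f y = f' y" and u: "u \<in> tangent A x"
  shows "differential A B f' x u = differential A B f x u"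
proof
  fix c'
  have x: "x \<in> carrier A" using f by (auto simp: differentiable_map_at_def)
  have fx: "f' x = f x" using eq[OF x] by simp
  show "differential A B f' x u c' = differential A B f x u c'"
  proof (cases "c' \<in> B \<and> f x \<in> fst c'")
    case True
    let ?c = "chart_at A x"
    have f': "differentiable_map_at A B f' x" by (rule differentiable_map_at_cong[OF f eq])
    have "differential A B f' x u c' = chart_deriv ?c c' f' x (u ?c)"
      by (rule differential_eq[OF A f' u]) (use True fx chart_at[OF x] in auto)
    also have "chart_deriv ?c c' f' x = chart_deriv ?c c' f x"
      by (rule chart_deriv_cong[OF f eq]) (use True chart_at[OF x] in auto)
    also have "chart_deriv ?c c' f x (u ?c) = differential A B f x u c'"
      by (rule differential_eq[OF A f u, symmetric]) (use True chart_at[OF x] in auto)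
    finally show ?thesis .
  next
    case False
    then show ?thesis by (simp only: differential_outside fx not_False_eq_True)
  qed
qed

lemma differential_id:
  assumes A: "differentiable_atlas A" and x: "x \<in> carrier A" and u: "u \<in> tangent A x"
  shows "differential A A (\<lambda>x. x) x u = u"
proof (rule tangent_eqI)
  show "differential A A (\<lambda>x. x) x u \<in> tangent A x"
    using differential_tangent[OF A A differentiable_atlas_id[OF A x] u] .
  show "differential A A (\<lambda>x. x) x u (chart_at A x) = u (chart_at A x)"
    using differential_eq[OF A differentiable_atlas_id[OF A x] u, of "chart_at A x" "chart_at A x"]
      tangentD[OF u, of "chart_at A x" "chart_at A x"] chart_at[OF x] by metis
qed (use u chart_at[OF x] in auto)

lemma differential_lincomb:
  assumes A: "differentiable_atlas A" and f: "differentiable_map_at A B f x"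
    and u: "u \<in> tangent A x" and v: "v \<in> tangent A x"
  shows "differential A B f x (\<lambda>c. a *\<^sub>R u c + b *\<^sub>R v c) =
    (\<lambda>c. a *\<^sub>R differential A B f x u c + b *\<^sub>R differential A B f x v c)"
proof
  fix c'
  have x: "x \<in> carrier A" using f by (auto simp: differentiable_map_at_def)
  note c = chart_at[OF x]
  show "differential A B f x (\<lambda>c. a *\<^sub>R u c + b *\<^sub>R v c) c' =
    a *\<^sub>R differential A B f x u c' + b *\<^sub>R differential A B f x v c'"
  proof (cases "c' \<in> B \<and> f x \<in> fst c'")
    case True
    then have "linear (chart_deriv (chart_at A x) c' f x)"
      using linear_chart_deriv[OF f] c by simp
    then show ?thesis
      using True differential_eq[OF A f u, of "chart_at A x" c'] differential_eq[OF A f v, of "chart_at A x" c']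
        differential_eq[OF A f tangent_lincomb[OF A x u v], of "chart_at A x" c' a b] c
      by (simp add: linear_add linear_scale)
  next
    case False
    then show ?thesis by (simp add: differential_outside)
  qed
qed

text \<open>Functoriality applied to the two compositions of f and its inverse. These are identities
  only on the carriers, which is why \<open>differential_cong\<close> intervenes.\<close>

lemma diffeomorphism_differential_inv:
  assumes f: "diffeomorphism A B f" and A: "differentiable_atlas A" and B: "differentiable_atlas B"
    and x: "x \<in> carrier A"
  shows "u \<in> tangent A x \<Longrightarrow>
      differential B A (inv_into (carrier A) f) (f x) (differential A B f x u) = u"
    and "v \<in> tangent B (f x) \<Longrightarrow>
      differential A B f x (differential B A (inv_into (carrier A) f) (f x) v) = v"
proof -
  let ?i = "inv_into (carrier A) f"
  note inv = diffeomorphism_inv[OF f]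
  note d = diffeomorphism_differentiable[OF f]
  have df: "differentiable_map_at A B f x" and di: "differentiable_map_at B A ?i (f x)"
    using d x inv A B by (auto simp: differentiable_atlas_def)
  { assume u: "u \<in> tangent A x"
    have "differential B A ?i (f x) (differential A B f x u) = differential A A (?i \<circ> f) x u"
      by (rule differential_comp[OF A B df di u])
    also have "\<dots> = differential A A (\<lambda>x. x) x u"
      by (rule differential_cong[OF A differentiable_atlas_id[OF A x] _ u]) (use inv in auto)
    also have "\<dots> = u" by (rule differential_id[OF A x u])
    finally show "differential B A ?i (f x) (differential A B f x u) = u" . }
  { assume v: "v \<in> tangent B (f x)"
    have fx: "f x \<in> carrier B" using inv x by simp
    have "differential A B f (?i (f x)) (differential B A ?i (f x) v) = differential B B (f \<circ> ?i) (f x) v"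
      by (rule differential_comp[OF B A di _ v]) (use df inv x in auto)
    also have "\<dots> = differential B B (\<lambda>x. x) (f x) v"
      by (rule differential_cong[OF B differentiable_atlas_id[OF B fx] _ v]) (use inv in auto)
    also have "\<dots> = v" by (rule differential_id[OF B fx v])
    finally show "differential A B f x (differential B A ?i (f x) v) = v"
      using inv x by simp }
qed

section \<open>Bundle charts\<close>

lemma dim2_expansion:
  fixes u v w :: "real^2"
  assumes "det (vector [u, v] :: real^2^2) \<noteq> 0"
  obtains a b where "w = a *\<^sub>R u + b *\<^sub>R v"
proof
  define d where "d = u $ 1 * v $ 2 - u $ 2 * v $ 1"
  have d: "d \<noteq> 0" using assms by (simp add: d_def det_2 mult.commute)
  \<comment> \<open>Cramer's rule.\<close>
  show "w = ((w $ 1 * v $ 2 - w $ 2 * v $ 1) / d) *\<^sub>R u + ((u $ 1 * w $ 2 - u $ 2 * w $ 1) / d) *\<^sub>R v"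
    using d by (simp add: vec_eq_iff forall_2 field_simps) (simp add: d_def algebra_simps)
qed

lemma det_matrix_comp:
  fixes L M :: "real^'n \<Rightarrow> real^'n"
  assumes "linear L" "linear M"
  shows "det (matrix (\<lambda>x. M (L x))) = det (matrix M) * det (matrix L)"
  using matrix_compose[OF assms] by (simp add: o_def det_mul)

lemma vec2_eq: "(v::real^2) = v $ 1 *\<^sub>R axis 1 1 + v $ 2 *\<^sub>R axis 2 1"
  by (simp add: vec_eq_iff forall_2 axis_def)

text \<open>Here u and v are the rows of \<open>vector [u, v]\<close>, while the images of the basis
  vectors are the columns of \<open>matrix L\<close>; the transposition does not affect the
  determinant.\<close>

lemma det_vector_linear:
  fixes L :: "real^2 \<Rightarrow> real^2"
  assumes "linear L"
  shows "det (vector [L u, L v] :: real^2^2) = det (matrix L) * det (vector [u, v] :: real^2^2)"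
proof -
  have *: "L w $ i = w $ 1 * L (axis 1 1) $ i + w $ 2 * L (axis 2 1) $ i" for w i
    by (subst vec2_eq[of w]) (simp add: linear_add[OF assms] linear_scale[OF assms])
  show ?thesis
    unfolding det_2 matrix_def by (simp add: *[of u] *[of v] algebra_simps)
qed

text \<open>The bundle projection as seen in a bundle chart and the base chart from which it is
  built.\<close>

definition base_coords :: "real^3 \<Rightarrow> real^2" where
  "base_coords z = vector [z $ 1, z $ 2]"

lemma base_coords_nth [simp]: "base_coords z $ 1 = z $ 1" "base_coords z $ 2 = z $ 2"
  by (simp_all add: base_coords_def)

lemma linear_base_coords: "linear base_coords"
  by (rule linearI) (simp_all add: vec_eq_iff forall_2)

lemma base_coords_has_derivative: "(base_coords has_derivative base_coords) F"
  by (rule linear_imp_has_derivative[OF linear_base_coords])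

lemma continuous_base_coords: "isCont base_coords z"
  using base_coords_has_derivative has_derivative_continuous by blast

section \<open>The base surface and its metric in coordinates\<close>

locale oriented_surface =
  fixes X :: "'a topology" and A :: "('a, 2) chart set" and g :: "('a, 2) metric"
  assumes surface: "oriented_riemannian_surface X A g"
begin

abbreviation "G \<equiv> metric_coeff A g"

lemma open_chart: "c \<in> A \<Longrightarrow> open (snd c ` fst c)"
  using surface by (auto simp: oriented_riemannian_surface_def oriented_manifold_def)

lemma inj_chart: "c \<in> A \<Longrightarrow> inj_on (snd c) (fst c)"
proof -
  assume "c \<in> A"
  then have "openin X (fst c)"
    and hm: "homeomorphic_map (subtopology X (fst c)) (top_of_set (snd c ` fst c)) (snd c)"
    using surface by (auto simp: oriented_riemannian_surface_def oriented_manifold_def)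
  then have "topspace (subtopology X (fst c)) = fst c"
    using openin_subset by fastforce
  then show "inj_on (snd c) (fst c)"
    using homeomorphic_imp_injective_map[OF hm] by simp
qed

lemma smooth_id: "smooth_map A A (\<lambda>x. x)"
  using surface by (auto simp: oriented_riemannian_surface_def oriented_manifold_def)

lemma atlas: "differentiable_atlas A"
  using smooth_map_differentiable[OF smooth_id] inj_chart
  by (auto simp: differentiable_atlas_def)

lemma id_differentiable: "x \<in> carrier A \<Longrightarrow> differentiable_map_at A A (\<lambda>x. x) x"
  by (rule differentiable_atlas_id[OF atlas])

lemma transition_det:
  "c \<in> A \<Longrightarrow> c' \<in> A \<Longrightarrow> x \<in> fst c \<Longrightarrow> x \<in> fst c' \<Longrightarrow> det (matrix (chart_deriv c c' (\<lambda>x. x) x)) > 0"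
  using surface
  by (auto simp: oriented_riemannian_surface_def oriented_manifold_def orientation_preserving_def chart_deriv_def)

lemma linear_transition:
  "c \<in> A \<Longrightarrow> c' \<in> A \<Longrightarrow> x \<in> fst c \<Longrightarrow> x \<in> fst c' \<Longrightarrow> linear (chart_deriv c c' (\<lambda>x. x) x)"
  using linear_chart_deriv[OF id_differentiable] carrierI by metis

lemma metric: "riemannian_metric A g"
  using surface by (simp add: oriented_riemannian_surface_def)

lemma metric_sym:
  "x \<in> carrier A \<Longrightarrow> u \<in> tangent A x \<Longrightarrow> v \<in> tangent A x \<Longrightarrow> g x u v = g x v u"
  using metric unfolding riemannian_metric_def by blast

lemma metric_pos:
  "x \<in> carrier A \<Longrightarrow> u \<in> tangent A x \<Longrightarrow> u \<noteq> (\<lambda>c. 0) \<Longrightarrow> g x u u > 0"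
  using metric unfolding riemannian_metric_def by blast

lemma metric_lincomb_left:
  assumes x: "x \<in> carrier A" and u: "u \<in> tangent A x" and v: "v \<in> tangent A x" and w: "w \<in> tangent A x"
  shows "g x (\<lambda>c. a *\<^sub>R u c + b *\<^sub>R v c) w = a * g x u w + b * g x v w"
proof -
  have ax: "g x (\<lambda>c. r *\<^sub>R s c + t c) w = r * g x s w + g x t w"
    if "s \<in> tangent A x" "t \<in> tangent A x" for s t r
    using metric x w that unfolding riemannian_metric_def by blast
  note z = zero_tangent[OF atlas x]
  \<comment> \<open>The linearity axiom is stated for a u + v, so scalar multiples are reached by
    taking v = 0, which needs the value at the zero vector first.\<close>
  have 0: "g x (\<lambda>c. 0) w = 0"
    using ax[OF z z, of 1] by simp
  have bv: "g x (\<lambda>c. b *\<^sub>R v c) w = b * g x v w" "(\<lambda>c. b *\<^sub>R v c) \<in> tangent A x"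
    using ax[OF v z, of b] 0 tangent_lincomb[OF atlas x v z, of b 0] by auto
  show ?thesis
    using ax[OF u bv(2), of a] bv(1) by simp
qed

lemma metric_lincomb_right:
  assumes x: "x \<in> carrier A" and u: "u \<in> tangent A x" and v: "v \<in> tangent A x" and w: "w \<in> tangent A x"
  shows "g x w (\<lambda>c. a *\<^sub>R u c + b *\<^sub>R v c) = a * g x w u + b * g x w v"
  using metric_lincomb_left[OF x u v w] metric_sym[OF x w] u v tangent_lincomb[OF atlas x u v]
  by simp

lemma metric_coords:
  assumes c: "c \<in> A" "x \<in> fst c" and u: "u \<in> tangent A x" and v: "v \<in> tangent A x"
  shows "g x u v = (\<Sum>i\<in>UNIV. \<Sum>j\<in>UNIV. G c (snd c x) $ i $ j * u c $ i * v c $ j)"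
proof -
  have x: "x \<in> carrier A" using c by (rule carrierI)
  let ?e = "\<lambda>i. tvec_of A c x (axis i 1)"
  have e: "?e i \<in> tangent A x" for i by (rule tvec_of_tangent[OF atlas c])
  have dec: "w = (\<lambda>c'. w c $ 1 *\<^sub>R ?e 1 c' + w c $ 2 *\<^sub>R ?e 2 c')" (is "w = ?w") if w: "w \<in> tangent A x" for w
  proof (rule tangent_eqI[OF w _ c])
    show "?w \<in> tangent A x" by (rule tangent_lincomb[OF atlas x e e])
    show "w c = w c $ 1 *\<^sub>R ?e 1 c + w c $ 2 *\<^sub>R ?e 2 c"
      using vec2_eq[of "w c"] by (simp add: tvec_of_self[OF atlas c])
  qed
  have G: "G c (snd c x) $ i $ j = g x (?e i) (?e j)" for i j
    by (simp add: metric_coeff_def Let_def chart_inv_chart[OF inj_chart[OF c(1)] c(2)])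
  have ev: "g x (?e i) v = v c $ 1 * g x (?e i) (?e 1) + v c $ 2 * g x (?e i) (?e 2)" for i
    by (subst (1) dec[OF v]) (simp add: metric_lincomb_right[OF x e e e])
  have "g x u v = u c $ 1 * g x (?e 1) v + u c $ 2 * g x (?e 2) v"
    by (subst (1) dec[OF u]) (simp add: metric_lincomb_left[OF x e e v])
  then show ?thesis
    by (simp add: ev G sum_2 algebra_simps)
qed

lemma metric_coeff_sym:
  assumes "c \<in> A" "y \<in> snd c ` fst c"
  shows "G c y $ i $ j = G c y $ j $ i"
proof -
  have x: "chart_inv c y \<in> fst c" by (rule chart_inv_in[OF assms(2)])
  then show ?thesis
    unfolding metric_coeff_def Let_def vec_lambda_beta
    by (intro metric_sym carrierI[OF assms(1)] tvec_of_tangent[OF atlas assms(1)])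
qed

lemma metric_coeff_pos:
  assumes c: "c \<in> A" "y \<in> snd c ` fst c"
  shows "G c y $ 1 $ 1 > 0" "det (G c y) > 0"
proof -
  define x where "x = chart_inv c y"
  have x: "x \<in> fst c" "snd c x = y" using c by (simp_all add: x_def chart_inv_in chart_chart_inv)
  have pos: "G c y $ 1 $ 1 * (w $ 1)\<^sup>2 + 2 * G c y $ 1 $ 2 * w $ 1 * w $ 2 + G c y $ 2 $ 2 * (w $ 2)\<^sup>2 > 0"
    if "w \<noteq> 0" for w :: "real^2"
  proof -
    have t: "tvec_of A c x w \<in> tangent A x" by (rule tvec_of_tangent[OF atlas c(1) x(1)])
    have "tvec_of A c x w \<noteq> (\<lambda>c. 0)"
      using that tvec_of_self[OF atlas c(1) x(1), of w] by metis
    then have "g x (tvec_of A c x w) (tvec_of A c x w) > 0"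
      by (rule metric_pos[OF carrierI[OF c(1) x(1)] t])
    then show ?thesis
      unfolding metric_coords[OF c(1) x(1) t t] x(2)
      by (simp add: sum_2 tvec_of_self[OF atlas c(1) x(1)] metric_coeff_sym[OF c, of 2 1] power2_eq_square algebra_simps)
  qed
  have "axis 1 1 \<noteq> (0 :: real^2)" by (simp add: axis_eq_0_iff)
  from pos[OF this] show 1: "G c y $ 1 $ 1 > 0" by (simp add: axis_def)
  \<comment> \<open>This vector is orthogonal to the first coordinate vector, and the quadratic form
    takes the value G11 * det G on it. Positivity of G11 then gives the sign of the
    determinant.\<close>
  define w :: "real^2" where "w = vector [- G c y $ 1 $ 2, G c y $ 1 $ 1]"
  have "w \<noteq> 0" using 1 by (auto simp: w_def vec_eq_iff forall_2)
  from pos[OF this] have "G c y $ 1 $ 1 * det (G c y) > 0"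
    by (simp add: w_def det_2 metric_coeff_sym[OF c, of 2 1] power2_eq_square algebra_simps)
  then show "det (G c y) > 0" using 1 by (simp add: zero_less_mult_iff)
qed

section \<open>Orthonormal frames and their rotations\<close>

lemma SO_bundleD:
  assumes "p \<in> SO_bundle A g"
  shows "fst p \<in> carrier A" "fst (snd p) \<in> tangent A (fst p)" "snd (snd p) \<in> tangent A (fst p)"
    "g (fst p) (fst (snd p)) (fst (snd p)) = 1" "g (fst p) (snd (snd p)) (snd (snd p)) = 1"
    "g (fst p) (fst (snd p)) (snd (snd p)) = 0"
    "c \<in> A \<Longrightarrow> fst p \<in> fst c \<Longrightarrow> det (vector [fst (snd p) c, snd (snd p) c] :: real^2^2) > 0"
  using assms unfolding SO_bundle_def by auto

lemma frame_rot_components [simp]: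
  "fst (frame_rot p \<phi>) = fst p"
  "fst (snd (frame_rot p \<phi>)) = (\<lambda>c. cos \<phi> *\<^sub>R fst (snd p) c + sin \<phi> *\<^sub>R snd (snd p) c)"
  "snd (snd (frame_rot p \<phi>)) = (\<lambda>c. (- sin \<phi>) *\<^sub>R fst (snd p) c + cos \<phi> *\<^sub>R snd (snd p) c)"
  by (simp_all add: frame_rot_def split: prod.split)

lemma frame_rot_add: "frame_rot (frame_rot p \<phi>) \<psi> = frame_rot p (\<phi> + \<psi>)"
proof (rule prod_eqI)
  show "snd (frame_rot (frame_rot p \<phi>) \<psi>) = snd (frame_rot p (\<phi> + \<psi>))"
    by (rule prod_eqI) (simp_all add: fun_eq_iff vec_eq_iff cos_add sin_add algebra_simps)
qed simp

lemma frame_rot_SO_bundle: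
  assumes p: "p \<in> SO_bundle A g"
  shows "frame_rot p \<phi> \<in> SO_bundle A g"
proof -
  obtain x e1 e2 where p_eq: "p = (x, e1, e2)" by (cases p) auto
  note P = SO_bundleD[OF p, unfolded p_eq fst_conv snd_conv]
  note sym = metric_sym[OF P(1) P(3) P(2)]
  note L = metric_lincomb_left[OF P(1) P(2) P(3)] metric_lincomb_right[OF P(1) P(2) P(3)]
  note T = tangent_lincomb[OF atlas P(1) P(2) P(3)]
  have sc: "(cos \<phi>)\<^sup>2 + (sin \<phi>)\<^sup>2 = 1" by simp
  \<comment> \<open>The change of frame has determinant C^2 + S^2, which is 1 for a rotation, so the
    frame stays positively oriented in every chart.\<close>
  have d: "det (vector [C *\<^sub>R e1 c + S *\<^sub>R e2 c, - S *\<^sub>R e1 c + C *\<^sub>R e2 c] :: real^2^2)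
      = (C\<^sup>2 + S\<^sup>2) * det (vector [e1 c, e2 c] :: real^2^2)" for c C S
    unfolding det_2 by (simp add: power2_eq_square algebra_simps)
  show ?thesis
    unfolding p_eq frame_rot_def SO_bundle_def
    using P sc by (simp add: T L d[of "cos \<phi>" _ "sin \<phi>", unfolded sc] sym del: scaleR_minus_left) (simp add: power2_eq_square algebra_simps)
qed

lemma chart_frame_components:
  "fst (chart_frame A g c y) = chart_inv c y"
  "fst (snd (chart_frame A g c y)) = tvec_of A c (chart_inv c y) ((1 / sqrt (G c y $ 1 $ 1)) *\<^sub>R vector [1, 0])"
  "snd (snd (chart_frame A g c y)) = tvec_of A c (chart_inv c y)
     ((1 / sqrt (G c y $ 1 $ 1 * det (G c y))) *\<^sub>R vector [- (G c y $ 1 $ 2), G c y $ 1 $ 1])"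
  by (simp_all add: chart_frame_def Let_def)

text \<open>The vector (- G12, G11) is orthogonal to the first coordinate vector and has squared
  length G11 * det G, which explains the normalising roots. Orientation is checked in c, where the
  frame matrix is triangular with positive diagonal, and passes to other charts because transition
  determinants are positive.\<close>

lemma chart_frame_SO_bundle:
  assumes c: "c \<in> A" "y \<in> snd c ` fst c"
  shows "chart_frame A g c y \<in> SO_bundle A g"
proof -
  define x where "x = chart_inv c y"
  have x: "x \<in> fst c" "snd c x = y" using c by (simp_all add: x_def chart_inv_in chart_chart_inv)
  note pos = metric_coeff_pos[OF c]
  define w1 w2 :: "real^2" where "w1 = (1 / sqrt (G c y $ 1 $ 1)) *\<^sub>R vector [1, 0]"
    and "w2 = (1 / sqrt (G c y $ 1 $ 1 * det (G c y))) *\<^sub>R vector [- (G c y $ 1 $ 2), G c y $ 1 $ 1]"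
  have cf: "chart_frame A g c y = (x, tvec_of A c x w1, tvec_of A c x w2)"
    by (simp add: chart_frame_def Let_def x_def w1_def w2_def)
  note t = tvec_of_tangent[OF atlas c(1) x(1)]
  define s r where "s = sqrt (G c y $ 1 $ 1)" and "r = sqrt (G c y $ 1 $ 1 * det (G c y))"
  have s: "s * s = G c y $ 1 $ 1" "s > 0" using pos by (auto simp: s_def)
  have r: "r * r = G c y $ 1 $ 1 * det (G c y)" "r > 0" using pos by (auto simp: r_def)
  have w: "w1 = vector [1 / s, 0]" "w2 = vector [- (G c y $ 1 $ 2) / r, G c y $ 1 $ 1 / r]"
    by (simp_all add: w1_def w2_def s_def r_def vec_eq_iff forall_2)
  have gw: "g x (tvec_of A c x u) (tvec_of A c x v) = (\<Sum>i\<in>UNIV. \<Sum>j\<in>UNIV. G c y $ i $ j * u $ i * v $ j)" for u v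
    using metric_coords[OF c(1) x(1) t t, of u v] by (simp add: x(2) tvec_of_self[OF atlas c(1) x(1)])
  have "g x (tvec_of A c x w1) (tvec_of A c x w1) = 1"
    using s pos by (simp add: gw sum_2 w)
  moreover have "g x (tvec_of A c x w1) (tvec_of A c x w2) = 0"
    by (simp add: gw sum_2 w)
  moreover have "g x (tvec_of A c x w2) (tvec_of A c x w2) = (G c y $ 1 $ 1 * det (G c y)) / (r * r)"
    using r(2) by (simp add: gw sum_2 w det_2 metric_coeff_sym[OF c, of 2 1] field_simps)
  then have "g x (tvec_of A c x w2) (tvec_of A c x w2) = 1"
    using r pos by simp
  moreover have "det (vector [tvec_of A c x w1 c', tvec_of A c x w2 c'] :: real^2^2) > 0"
    if c': "c' \<in> A" "x \<in> fst c'" for c'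
  proof -
    have "det (vector [w1, w2] :: real^2^2) > 0"
      unfolding det_2 using s r pos by (simp add: w)
    then show ?thesis
      using transition_det[OF c(1) c'(1) x(1) c'(2)] det_vector_linear[OF linear_transition[OF c(1) c'(1) x(1) c'(2)], of w1 w2]
      by (simp add: tvec_of_eq[OF c'])
  qed
  ultimately show ?thesis
    unfolding cf SO_bundle_def using t carrierI[OF c(1) x(1)] by simp
qed

text \<open>Pairing the rotated first vector with e1 and e2 by the metric reads off the cosine and
  the sine of the angle.\<close>

lemma frame_rot_eq_iff:
  assumes p: "p \<in> SO_bundle A g" and eq: "frame_rot p \<phi> = frame_rot p \<psi>"
  shows "cos \<phi> = cos \<psi>" "sin \<phi> = sin \<psi>"
proof -
  obtain x e1 e2 where p_eq: "p = (x, e1, e2)" by (cases p) auto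
  note P = SO_bundleD[OF p, unfolded p_eq fst_conv snd_conv]
  note L = metric_lincomb_right[OF P(1) P(2) P(3)]
  have "fst (snd (frame_rot p \<phi>)) = fst (snd (frame_rot p \<psi>))" using eq by simp
  then have "(\<lambda>c. cos \<phi> *\<^sub>R e1 c + sin \<phi> *\<^sub>R e2 c) = (\<lambda>c. cos \<psi> *\<^sub>R e1 c + sin \<psi> *\<^sub>R e2 c)"
    by (simp add: p_eq)
  then have "g x e1 (\<lambda>c. cos \<phi> *\<^sub>R e1 c + sin \<phi> *\<^sub>R e2 c) = g x e1 (\<lambda>c. cos \<psi> *\<^sub>R e1 c + sin \<psi> *\<^sub>R e2 c)"
    "g x e2 (\<lambda>c. cos \<phi> *\<^sub>R e1 c + sin \<phi> *\<^sub>R e2 c) = g x e2 (\<lambda>c. cos \<psi> *\<^sub>R e1 c + sin \<psi> *\<^sub>R e2 c)"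
    by simp_all
  then show "cos \<phi> = cos \<psi>" "sin \<phi> = sin \<psi>"
    using P metric_sym[OF P(1) P(3) P(2)] by (simp_all add: L)
qed

section \<open>The bundle atlas\<close>

abbreviation "SO \<equiv> SO_atlas A g"

text \<open>A name for the parameter domain that \<open>SO_chart\<close> introduces locally.\<close>

definition frame_dom :: "('a, 2) chart \<Rightarrow> real \<Rightarrow> (real^3) set" where
  "frame_dom c a = {z. base_coords z \<in> snd c ` fst c \<and> z $ 3 \<in> {a<..<a + 2 * pi}}"

lemma frame_param_eq: "frame_param A g c z = frame_rot (chart_frame A g c (base_coords z)) (z $ 3)"
  by (simp add: frame_param_def base_coords_def)

lemma frame_param_base: "fst (frame_param A g c z) = chart_inv c (base_coords z)"
  by (simp add: frame_param_eq chart_frame_components)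

lemma frame_param_SO_bundle:
  "c \<in> A \<Longrightarrow> z \<in> frame_dom c a \<Longrightarrow> frame_param A g c z \<in> SO_bundle A g"
  by (simp add: frame_param_eq frame_rot_SO_bundle chart_frame_SO_bundle frame_dom_def)

lemma frame_param_inj:
  assumes c: "c \<in> A"
  shows "inj_on (frame_param A g c) (frame_dom c a)"
proof (rule inj_onI)
  fix z z' assume z: "z \<in> frame_dom c a" "z' \<in> frame_dom c a"
    and eq: "frame_param A g c z = frame_param A g c z'"
  then have "chart_inv c (base_coords z) = chart_inv c (base_coords z')"
    by (metis frame_param_base)
  then have b: "base_coords z = base_coords z'"
    using z chart_chart_inv unfolding frame_dom_def by (metis (no_types, lifting) mem_Collect_eq)
  then have cs: "cos (z $ 3) = cos (z' $ 3)" "sin (z $ 3) = sin (z' $ 3)"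
    using frame_rot_eq_iff[OF chart_frame_SO_bundle[OF c], of "base_coords z" "z $ 3" "z' $ 3"] z eq
    by (auto simp: frame_param_eq frame_dom_def)
  \<comment> \<open>The angles differ by a multiple of a full turn. Both lie in an open interval of
    length \<open>2 * pi\<close>, so the multiple is zero.\<close>
  have "cos (z $ 3 - z' $ 3) = 1" using cs by (simp add: cos_diff flip: power2_eq_square)
  then obtain n :: int where n: "z $ 3 - z' $ 3 = n * (2 * pi)"
    by (auto simp: cos_one_2pi_int)
  have "\<bar>z $ 3 - z' $ 3\<bar> < 1 * (2 * pi)" using z by (auto simp: frame_dom_def)
  then have "\<bar>real_of_int n\<bar> < 1"
    unfolding n abs_mult using mult_less_cancel_right_pos[of "2 * pi"] by simp
  then have "n = 0" by linarith
  then have "z $ 3 = z' $ 3" using n by simp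
  moreover have "z $ 1 = z' $ 1" "z $ 2 = z' $ 2" using b by (metis base_coords_nth)+
  ultimately show "z = z'" by (simp add: vec_eq_iff forall_3)
qed

lemma SO_chart_simps:
  "fst (SO_chart A g c a) = frame_param A g c ` frame_dom c a"
  "snd (SO_chart A g c a) = inv_into (frame_dom c a) (frame_param A g c)"
  by (simp_all add: SO_chart_def Let_def frame_dom_def base_coords_def)

lemma SO_chart_frame_param:
  "c \<in> A \<Longrightarrow> z \<in> frame_dom c a \<Longrightarrow> snd (SO_chart A g c a) (frame_param A g c z) = z"
  by (simp add: SO_chart_simps frame_param_inj)

lemma SO_chart_image: "c \<in> A \<Longrightarrow> snd (SO_chart A g c a) ` fst (SO_chart A g c a) = frame_dom c a"
  by (force simp: SO_chart_simps(1) SO_chart_frame_param)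

lemma inj_SO_chart: "c \<in> A \<Longrightarrow> inj_on (snd (SO_chart A g c a)) (fst (SO_chart A g c a))"
  by (simp add: SO_chart_simps inj_on_inv_into)

lemma SO_atlasE:
  assumes "b \<in> SO"
  obtains c a where "c \<in> A" "b = SO_chart A g c a"
  using assms unfolding SO_atlas_def by blast

lemma inj_SO: "\<forall>b\<in>SO. inj_on (snd b) (fst b)"
  using inj_SO_chart by (blast elim: SO_atlasE)

lemma SO_chart_inv:
  assumes "c \<in> A" "z \<in> frame_dom c a"
  shows "chart_inv (SO_chart A g c a) z = frame_param A g c z"
  using chart_inv_chart[OF inj_SO_chart[OF assms(1)], of "frame_param A g c z" a] assms
  by (simp add: SO_chart_frame_param) (simp add: SO_chart_simps)

lemma SO_chart_coords:
  assumes "c \<in> A" "q \<in> fst (SO_chart A g c a)"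
  shows "snd (SO_chart A g c a) q \<in> frame_dom c a"
    "frame_param A g c (snd (SO_chart A g c a) q) = q"
    "fst q \<in> fst c" "base_coords (snd (SO_chart A g c a) q) = snd c (fst q)"
proof -
  from assms obtain z where z: "z \<in> frame_dom c a" "q = frame_param A g c z"
    by (auto simp: SO_chart_simps)
  then show "snd (SO_chart A g c a) q \<in> frame_dom c a" "frame_param A g c (snd (SO_chart A g c a) q) = q"
    by (simp_all add: SO_chart_frame_param assms)
  have "base_coords z \<in> snd c ` fst c" using z by (simp add: frame_dom_def)
  then show "fst q \<in> fst c" "base_coords (snd (SO_chart A g c a) q) = snd c (fst q)"
    by (simp_all add: z SO_chart_frame_param assms frame_param_base chart_inv_in chart_chart_inv)
qed

lemma carrier_SO_E:
  assumes "q \<in> carrier SO"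
  obtains c a where "c \<in> A" "q \<in> fst (SO_chart A g c a)"
  using assms unfolding carrier_def by (blast elim: SO_atlasE)

text \<open>Diffeomorphisms and isometries refer to \<open>carrier SO\<close>, whereas
  \<open>projects_to\<close> and \<open>fibre_orientation_preserving\<close> quantify over
  \<open>SO_bundle A g\<close>; this inclusion makes their conditions available on the
  carrier.\<close>

lemma carrier_SO_bundle: "q \<in> carrier SO \<Longrightarrow> q \<in> SO_bundle A g"
  by (erule carrier_SO_E) (auto simp: SO_chart_simps(1) frame_param_SO_bundle)

lemma SO_chart_in: "c \<in> A \<Longrightarrow> SO_chart A g c a \<in> SO"
  unfolding SO_atlas_def by blast

lemma SO_fibre:
  assumes c: "c \<in> A" "x \<in> fst c"
  obtains q where "q \<in> fst (SO_chart A g c (- pi))" "fst q = x"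
proof
  \<comment> \<open>The witness is the Gram-Schmidt frame itself, at angle 0. The chart parameter
    \<open>- pi\<close> is chosen so that the angle interval contains 0.\<close>
  let ?z = "vector [snd c x $ 1, snd c x $ 2, 0] :: real^3"
  have b: "base_coords ?z = snd c x" by (simp add: vec_eq_iff forall_2)
  then have "?z \<in> frame_dom c (- pi)" using c by (simp add: frame_dom_def)
  then show "frame_param A g c ?z \<in> fst (SO_chart A g c (- pi))" by (simp add: SO_chart_simps)
  show "fst (frame_param A g c ?z) = x"
    by (simp add: frame_param_base b chart_inv_chart[OF inj_chart] c)
qed

lemma open_frame_dom: "c \<in> A \<Longrightarrow> open (frame_dom c a)"
proof -
  assume "c \<in> A"
  then have "open (base_coords -` (snd c ` fst c))"
    using open_vimage[OF open_chart] continuous_base_coords continuous_at_imp_continuous_on by blast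
  moreover have "open {z :: real^3. z $ 3 \<in> {a<..<a + 2 * pi}}"
    by (auto intro!: open_Collect_conj open_Collect_less continuous_intros)
  ultimately have "open (base_coords -` (snd c ` fst c) \<inter> {z :: real^3. z $ 3 \<in> {a<..<a + 2 * pi}})" by auto
  moreover have "frame_dom c a = base_coords -` (snd c ` fst c) \<inter> {z. z $ 3 \<in> {a<..<a + 2 * pi}}"
    by (auto simp: frame_dom_def)
  ultimately show "open (frame_dom c a)" by simp
qed

subsection \<open>The Levi-Civita connection is metric\<close>

lemma metric_coeff_differentiable:
  assumes "c \<in> A" "y \<in> snd c ` fst c"
  shows "(\<lambda>z. G c z $ i $ j) differentiable (at y)"
proof -
  have "smooth_on (snd c ` fst c) (G c)"
    using metric assms unfolding riemannian_metric_def by blast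
  from smooth_on_differentiable[OF this assms(2)] show ?thesis
    by (intro nth_differentiable)
qed

lemma metric_pderiv_sym:
  assumes c: "c \<in> A" "y \<in> snd c ` fst c"
  shows "pderiv_at k (\<lambda>z. G c z $ i $ j) y = pderiv_at k (\<lambda>z. G c z $ j $ i) y"
proof -
  have "\<forall>\<^sub>F z in nhds y. z \<in> snd c ` fst c"
    using eventually_nhds open_chart c by blast
  then have "\<forall>\<^sub>F z in nhds y. G c z $ i $ j = G c z $ j $ i"
    by eventually_elim (rule metric_coeff_sym[OF c(1)])
  then show ?thesis
    unfolding pderiv_at_def by (simp only: frechet_derivative_cong_nhds)
qed

text \<open>Multiplying by the metric cancels the inverse matrix in \<open>christoffel\<close>,
  leaving the Christoffel symbols of the first kind.\<close>

lemma christoffel_lowered: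
  assumes c: "c \<in> A" "y \<in> snd c ` fst c"
  shows "(\<Sum>m\<in>UNIV. G c y $ j $ m * christoffel A g c y m k i) =
    (pderiv_at k (\<lambda>z. G c z $ i $ j) y + pderiv_at i (\<lambda>z. G c z $ k $ j) y
      - pderiv_at j (\<lambda>z. G c z $ k $ i) y) / 2"
proof -
  define T where "T l = pderiv_at k (\<lambda>z. G c z $ i $ l) y + pderiv_at i (\<lambda>z. G c z $ k $ l) y
      - pderiv_at l (\<lambda>z. G c z $ k $ i) y" for l
  have "invertible (G c y)"
    using metric_coeff_pos(2)[OF c] by (simp add: invertible_det_nz)
  then have "G c y ** matrix_inv (G c y) = mat 1"
    unfolding invertible_def matrix_inv_def by (metis (mono_tags, lifting) someI_ex)
  then have inv: "(\<Sum>m\<in>UNIV. G c y $ j $ m * matrix_inv (G c y) $ m $ l) = (if j = l then 1 else 0)" for l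
    by (simp add: matrix_matrix_mult_def mat_def vec_eq_iff)
  have "(\<Sum>m\<in>UNIV. G c y $ j $ m * christoffel A g c y m k i) =
      (\<Sum>m\<in>UNIV. \<Sum>l\<in>UNIV. G c y $ j $ m * matrix_inv (G c y) $ m $ l * T l / 2)"
    by (simp add: christoffel_def Let_def T_def sum_distrib_left mult.assoc)
  also have "\<dots> = (\<Sum>l\<in>UNIV. \<Sum>m\<in>UNIV. G c y $ j $ m * matrix_inv (G c y) $ m $ l * T l / 2)"
    by (rule sum.swap)
  also have "\<dots> = (\<Sum>l\<in>UNIV. (\<Sum>m\<in>UNIV. G c y $ j $ m * matrix_inv (G c y) $ m $ l) * T l / 2)"
    by (simp add: sum_distrib_right sum_divide_distrib)
  also have "\<dots> = (\<Sum>l\<in>UNIV. if j = l then T l / 2 else 0)"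
    unfolding inv by (rule sum.cong) auto
  also have "\<dots> = T j / 2" by simp
  finally show ?thesis by (simp add: T_def)
qed

text \<open>In the sum of the two lowered symbols, the derivatives in the directions i and j cancel
  by symmetry of the metric, and the two halves of the derivative in direction k add up.\<close>

lemma metric_compatible:
  assumes c: "c \<in> A" "y \<in> snd c ` fst c"
  shows "pderiv_at k (\<lambda>z. G c z $ i $ j) y =
    (\<Sum>m\<in>UNIV. G c y $ j $ m * christoffel A g c y m k i) +
    (\<Sum>m\<in>UNIV. G c y $ i $ m * christoffel A g c y m k j)"
  unfolding christoffel_lowered[OF c]
  by (simp add: metric_pderiv_sym[OF c, of k j i] metric_pderiv_sym[OF c, of j k i]
      metric_pderiv_sym[OF c, of i k j] field_simps)

section \<open>Differentiability of frames and of the bundle projection\<close>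

lemma tvec_of_differentiable:
  assumes c: "c \<in> A" "c' \<in> A" "x \<in> fst c" "x \<in> fst c'"
    and w: "(\<lambda>y. w y $ 1) differentiable (at (snd c x))" "(\<lambda>y. w y $ 2) differentiable (at (snd c x))"
  shows "(\<lambda>y. tvec_of A c (chart_inv c y) (w y) c') differentiable (at (snd c x))"
proof -
  let ?T = "snd c' \<circ> chart_inv c"
  let ?W = "snd c ` (fst c \<inter> fst c')"
  have "open ?W \<and> smooth_on ?W (snd c' \<circ> (\<lambda>x. x) \<circ> chart_inv c)"
    using smooth_id c unfolding smooth_map_def Let_def by simp
  then have W: "open ?W" "smooth_on ?W ?T" by (simp_all add: o_def)
  have xW: "snd c x \<in> ?W" using c by auto
  \<comment> \<open>In the chart c' the components are the Jacobian of the transition map applied to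
    w. Differentiating them in y uses second derivatives of the transition map, hence smoothness
    beyond first order.\<close>
  have D: "(\<lambda>y. frechet_derivative ?T (at y) v) differentiable (at (snd c x))" for v
    by (rule smooth_on_deriv_differentiable[OF W(2) xW])
  have "\<forall>\<^sub>F y in nhds (snd c x). y \<in> ?W" using W(1) xW eventually_nhds by blast
  then have ev: "\<forall>\<^sub>F y in nhds (snd c x).
      w y $ 1 *\<^sub>R frechet_derivative ?T (at y) (axis 1 1) + w y $ 2 *\<^sub>R frechet_derivative ?T (at y) (axis 2 1)
      = tvec_of A c (chart_inv c y) (w y) c'"
  proof eventually_elim
    case (elim y)
    then have y: "y \<in> snd c ` fst c" "chart_inv c y \<in> fst c'"
      using chart_inv_chart[OF inj_chart[OF c(1)]] by auto
    have "linear (frechet_derivative ?T (at y))"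
      using smooth_on_differentiable[OF W(2) elim] by (rule linear_frechet_derivative)
    then have "frechet_derivative ?T (at y) (w y) =
      w y $ 1 *\<^sub>R frechet_derivative ?T (at y) (axis 1 1) + w y $ 2 *\<^sub>R frechet_derivative ?T (at y) (axis 2 1)"
      by (subst vec2_eq[of "w y"]) (simp add: linear_add linear_scale)
    then show ?case
      using c(2) y by (simp add: tvec_of_def chart_chart_inv)
  qed
  have "(\<lambda>y. w y $ 1 *\<^sub>R frechet_derivative ?T (at y) (axis 1 1)
      + w y $ 2 *\<^sub>R frechet_derivative ?T (at y) (axis 2 1)) differentiable (at (snd c x))"
    by (intro differentiable_add differentiable_scaleR w D)
  then show ?thesis
    using has_derivative_transform_nhds[OF _ ev] unfolding differentiable_def by blast
qed

text \<open>The components are taken in a chart c' that may differ from c, because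
  \<open>cov_deriv\<close> evaluates frames in a chart chosen independently of the bundle
  chart.\<close>

lemma chart_frame_differentiable:
  assumes c: "c \<in> A" "c' \<in> A" "x \<in> fst c" "x \<in> fst c'"
  shows "(\<lambda>y. fst (snd (chart_frame A g c y)) c') differentiable (at (snd c x))"
    "(\<lambda>y. snd (snd (chart_frame A g c y)) c') differentiable (at (snd c x))"
proof -
  have y: "snd c x \<in> snd c ` fst c" using c by simp
  note pos = metric_coeff_pos[OF c(1) y]
  note dG = metric_coeff_differentiable[OF c(1) y]
  have sq: "(\<lambda>y. 1 / sqrt (h y)) differentiable (at (snd c x))"
    if "h differentiable (at (snd c x))" "h (snd c x) > 0" for h :: "real^2 \<Rightarrow> real"
  proof -
    have "sqrt differentiable (at (h (snd c x)))"
      using DERIV_real_sqrt[OF that(2)] real_differentiable_def by blast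
    from differentiable_compose[OF this that(1)]
    have "(\<lambda>y. sqrt (h y)) differentiable (at (snd c x))" .
    then show ?thesis using that(2) by (intro differentiable_divide) auto
  qed
  have d11: "(\<lambda>y. 1 / sqrt (G c y $ 1 $ 1)) differentiable (at (snd c x))"
    by (rule sq[OF dG pos(1)])
  have d22: "(\<lambda>y. 1 / sqrt (G c y $ 1 $ 1 * det (G c y))) differentiable (at (snd c x))"
  proof (rule sq)
    show "(\<lambda>y. G c y $ 1 $ 1 * det (G c y)) differentiable (at (snd c x))"
      unfolding det_2 by (intro differentiable_mult differentiable_diff dG)
  qed (use pos in simp)
  show "(\<lambda>y. fst (snd (chart_frame A g c y)) c') differentiable (at (snd c x))"
    unfolding chart_frame_components
    by (rule tvec_of_differentiable[OF c]) (use d11 in simp_all)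
  show "(\<lambda>y. snd (snd (chart_frame A g c y)) c') differentiable (at (snd c x))"
    unfolding chart_frame_components
  proof (rule tvec_of_differentiable[OF c])
    show "(\<lambda>y. ((1 / sqrt (G c y $ 1 $ 1 * det (G c y))) *\<^sub>R vector [- G c y $ 1 $ 2, G c y $ 1 $ 1] :: real^2) $ 1)
      differentiable (at (snd c x))"
      using differentiable_mult[OF d22 differentiable_minus[OF dG, of 1 2]] by simp
    show "(\<lambda>y. ((1 / sqrt (G c y $ 1 $ 1 * det (G c y))) *\<^sub>R vector [- G c y $ 1 $ 2, G c y $ 1 $ 1] :: real^2) $ 2)
      differentiable (at (snd c x))"
      using differentiable_mult[OF d22 dG, of 1 1] by simp
  qed
qed

lemma frame_param_differentiable:
  assumes c: "c \<in> A" "c' \<in> A" and z: "z \<in> frame_dom c a" "fst (frame_param A g c z) \<in> fst c'"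
  shows "(\<lambda>z. fst (snd (frame_param A g c z)) c') differentiable (at z)"
    "(\<lambda>z. snd (snd (frame_param A g c z)) c') differentiable (at z)"
proof -
  define x where "x = chart_inv c (base_coords z)"
  have x: "x \<in> fst c" "x \<in> fst c'" "snd c x = base_coords z"
    using z by (auto simp: x_def frame_dom_def frame_param_base chart_inv_in chart_chart_inv)
  note F = chart_frame_differentiable[OF c x(1,2), unfolded x(3)]
  have b: "base_coords differentiable (at z)"
    using base_coords_has_derivative by (rule differentiableI)
  note F' = differentiable_compose[OF F(1) b] differentiable_compose[OF F(2) b]
  have d3: "(\<lambda>z :: real^3. z $ 3) differentiable (at z)"
    by (rule nth_differentiable) simp
  have "sin differentiable (at (z $ 3))" "cos differentiable (at (z $ 3))"
    using DERIV_sin DERIV_cos real_differentiable_def by blast+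
  then have sc: "(\<lambda>z :: real^3. sin (z $ 3)) differentiable (at z)" "(\<lambda>z :: real^3. cos (z $ 3)) differentiable (at z)"
    using differentiable_compose[OF _ d3] by blast+
  show "(\<lambda>z. fst (snd (frame_param A g c z)) c') differentiable (at z)"
    unfolding frame_param_eq frame_rot_components
    by (intro differentiable_add differentiable_scaleR sc F')
  show "(\<lambda>z. snd (snd (frame_param A g c z)) c') differentiable (at z)"
    unfolding frame_param_eq frame_rot_components
    by (intro differentiable_add differentiable_scaleR differentiable_minus sc F')
qed

text \<open>In coordinates the base point is a transition map of the surface composed with the
  linear map \<open>base_coords\<close>, so differentiability of the projection rests only on the
  atlas of the surface.\<close>

lemma base_map_has_derivative:
  assumes c: "c \<in> A" "c' \<in> A" and z: "z \<in> frame_dom c a" "fst (frame_param A g c z) \<in> fst c'"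
  shows "((\<lambda>z. snd c' (fst (frame_param A g c z))) has_derivative
      (\<lambda>\<xi>. chart_deriv c c' (\<lambda>x. x) (fst (frame_param A g c z)) (base_coords \<xi>))) (at z)"
    "\<forall>\<^sub>F z in nhds z. z \<in> frame_dom c a \<and> fst (frame_param A g c z) \<in> fst c'"
proof -
  define x where "x = chart_inv c (base_coords z)"
  have x: "x \<in> fst c" "x \<in> fst c'" "snd c x = base_coords z"
    using z by (auto simp: x_def frame_dom_def frame_param_base chart_inv_in chart_chart_inv)
  have id: "differentiable_map_at A A (\<lambda>x. x) x" by (rule id_differentiable[OF carrierI[OF c(1) x(1)]])
  have "(snd c' \<circ> (\<lambda>x. x) \<circ> chart_inv c has_derivative chart_deriv c c' (\<lambda>x. x) x) (at (base_coords z))"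
    using chart_has_derivative[OF id c x(1,2)] x(3) by simp
  from diff_chain_at[OF base_coords_has_derivative this]
  show "((\<lambda>z. snd c' (fst (frame_param A g c z))) has_derivative
      (\<lambda>\<xi>. chart_deriv c c' (\<lambda>x. x) (fst (frame_param A g c z)) (base_coords \<xi>))) (at z)"
    by (simp add: frame_param_base o_def x_def)
  have e1: "\<forall>\<^sub>F z in nhds z. z \<in> frame_dom c a"
    using eventually_nhds open_frame_dom[OF c(1)] z(1) by blast
  have "\<forall>\<^sub>F y in nhds (base_coords z). chart_inv c y \<in> fst c'"
    using chart_eventually[OF id c x(1,2)] x(3) by (auto elim: eventually_mono)
  moreover have "filterlim base_coords (nhds (base_coords z)) (nhds z)"
    using continuous_base_coords by (metis isCont_def tendsto_at_iff_tendsto_nhds)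
  ultimately have "\<forall>\<^sub>F z in nhds z. chart_inv c (base_coords z) \<in> fst c'"
    unfolding filterlim_iff by blast
  with e1 show "\<forall>\<^sub>F z in nhds z. z \<in> frame_dom c a \<and> fst (frame_param A g c z) \<in> fst c'"
    by eventually_elim (simp add: frame_param_base)
qed

lemma projection_chart:
  assumes c: "c \<in> A" "c' \<in> A" and q: "q \<in> fst (SO_chart A g c a)" "fst q \<in> fst c'"
  shows "((snd c' \<circ> fst \<circ> chart_inv (SO_chart A g c a)) has_derivative
      (\<lambda>\<xi>. chart_deriv c c' (\<lambda>x. x) (fst q) (base_coords \<xi>))) (at (snd (SO_chart A g c a) q))"
    "\<forall>\<^sub>F z in nhds (snd (SO_chart A g c a) q).
      z \<in> snd (SO_chart A g c a) ` fst (SO_chart A g c a) \<and> fst (chart_inv (SO_chart A g c a) z) \<in> fst c'"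
proof -
  note z = SO_chart_coords[OF c(1) q(1)]
  have z2: "fst (frame_param A g c (snd (SO_chart A g c a) q)) \<in> fst c'" using z q by simp
  note b = base_map_has_derivative[OF c z(1) z2, unfolded z(2)]
  show "((snd c' \<circ> fst \<circ> chart_inv (SO_chart A g c a)) has_derivative
      (\<lambda>\<xi>. chart_deriv c c' (\<lambda>x. x) (fst q) (base_coords \<xi>))) (at (snd (SO_chart A g c a) q))"
    by (rule has_derivative_transform_nhds[OF b(1)])
      (use b(2) in eventually_elim, simp add: SO_chart_inv[OF c(1)])
  show "\<forall>\<^sub>F z in nhds (snd (SO_chart A g c a) q).
      z \<in> snd (SO_chart A g c a) ` fst (SO_chart A g c a) \<and> fst (chart_inv (SO_chart A g c a) z) \<in> fst c'"
    unfolding SO_chart_image[OF c(1)] using b(2)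
    by eventually_elim (simp add: SO_chart_inv[OF c(1)])
qed

lemma projection_differentiable:
  assumes q: "q \<in> carrier SO"
  shows "differentiable_map_at SO A fst q"
  unfolding differentiable_map_at_def
proof (intro conjI ballI impI)
  show "q \<in> carrier SO" "fst q \<in> carrier A"
    using q SO_bundleD(1)[OF carrier_SO_bundle[OF q]] by auto
  fix b c' assume b: "b \<in> SO" and c': "c' \<in> A" "q \<in> fst b" "fst q \<in> fst c'"
  from b obtain c a where c: "c \<in> A" "b = SO_chart A g c a" by (rule SO_atlasE)
  note * = projection_chart[OF c(1) c'(1), of q a, folded c(2), OF c'(2,3)]
  show "\<forall>\<^sub>F z in nhds (snd b q). z \<in> snd b ` fst b \<and> fst (chart_inv b z) \<in> fst c'"
    by (rule *(2))
  show "snd c' \<circ> fst \<circ> chart_inv b differentiable at (snd b q)"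
    using *(1) by (rule differentiableI)
qed

lemma projection_chart_deriv:
  assumes "c \<in> A" "c' \<in> A" "q \<in> fst (SO_chart A g c a)" "fst q \<in> fst c'"
  shows "chart_deriv (SO_chart A g c a) c' fst q \<xi> = chart_deriv c c' (\<lambda>x. x) (fst q) (base_coords \<xi>)"
  using frechet_derivative_at[OF projection_chart(1)[OF assms]] by (simp add: chart_deriv_def fun_eq_iff)

lemma frame_dom_shift:
  assumes c: "c \<in> A" and z: "z \<in> frame_dom c a"
  shows "\<forall>\<^sub>F t in nhds 0. z + t *\<^sub>R axis 3 1 \<in> frame_dom c a"
    "frame_param A g c (z + t *\<^sub>R axis 3 1) = frame_rot (frame_param A g c z) t"
proof -
  have "((\<lambda>t. z + t *\<^sub>R axis 3 1) \<longlongrightarrow> z + 0 *\<^sub>R axis 3 1) (nhds (0::real))"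
    by (intro tendsto_intros) (simp add: filterlim_ident)
  moreover have "\<forall>\<^sub>F y in nhds z. y \<in> frame_dom c a"
    using eventually_nhds open_frame_dom[OF c] z by blast
  ultimately show "\<forall>\<^sub>F t in nhds 0. z + t *\<^sub>R axis 3 1 \<in> frame_dom c a"
    unfolding filterlim_iff scaleR_zero_left add_0_right by blast
  have "base_coords (z + t *\<^sub>R axis 3 1) = base_coords z" "(z + t *\<^sub>R axis 3 1) $ 3 = z $ 3 + t"
    by (simp_all add: vec_eq_iff forall_2 axis_def)
  then show "frame_param A g c (z + t *\<^sub>R axis 3 1) = frame_rot (frame_param A g c z) t"
    by (simp only: frame_param_eq frame_rot_add)
qed

text \<open>Rotating a frame translates its angle coordinate, so the generator is the third
  coordinate vector in every bundle chart.\<close>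

lemma vert_gen_chart:
  assumes b: "b \<in> SO" "q \<in> fst b"
  shows "vert_gen A g q b = axis 3 1"
proof -
  from b(1) obtain c a where c: "c \<in> A" "b = SO_chart A g c a" by (rule SO_atlasE)
  define z where "z = snd b q"
  have z: "z \<in> frame_dom c a" "frame_param A g c z = q"
    using SO_chart_coords[OF c(1), of q a] b(2) by (simp_all add: z_def c(2))
  have "((\<lambda>t. z + t *\<^sub>R axis 3 1) has_derivative (\<lambda>t. t *\<^sub>R axis 3 1)) (at (0::real))"
    by (auto intro!: derivative_eq_intros)
  moreover have "\<forall>\<^sub>F t in nhds 0. z + t *\<^sub>R axis 3 1 = snd b (frame_rot q t)"
    using frame_dom_shift(1)[OF c(1) z(1)]
    by eventually_elim (use SO_chart_frame_param[OF c(1)] frame_dom_shift(2)[OF c(1) z(1)] z(2) c(2) in metis)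
  ultimately have "((\<lambda>t. snd b (frame_rot q t)) has_derivative (\<lambda>t. t *\<^sub>R axis 3 1)) (at 0)"
    by (rule has_derivative_transform_nhds)
  then have "vector_derivative (\<lambda>t. snd b (frame_rot q t)) (at 0) = axis 3 1"
    by (intro vector_derivative_at) (simp add: has_vector_derivative_def)
  then show ?thesis using b by (simp add: vert_gen_def)
qed

subsection \<open>Horizontal lifts\<close>

text \<open>The metric on bare coordinate vectors. Covariant derivatives are produced by
  \<open>cov_deriv\<close> as elements of \<open>real^2\<close>, not as members of
  \<open>tangent\<close>, so g cannot be applied to them directly.\<close>

definition inner_at :: "('a, 2) chart \<Rightarrow> real^2 \<Rightarrow> real^2 \<Rightarrow> real^2 \<Rightarrow> real" where
  "inner_at c y u v = (\<Sum>i\<in>UNIV. \<Sum>j\<in>UNIV. G c y $ i $ j * u $ i * v $ j)"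

definition connection_term :: "('a, 2) chart \<Rightarrow> real^2 \<Rightarrow> real^2 \<Rightarrow> real^2 \<Rightarrow> real^2" where
  "connection_term c y u v = (\<chi> k. \<Sum>i\<in>UNIV. \<Sum>j\<in>UNIV. christoffel A g c y k i j * u $ i * v $ j)"

lemma inner_at_add:
  "inner_at c y (a *\<^sub>R u + b *\<^sub>R v) w = a * inner_at c y u w + b * inner_at c y v w"
  by (simp add: inner_at_def sum_2 algebra_simps)

lemma inner_at_sym: "c \<in> A \<Longrightarrow> y \<in> snd c ` fst c \<Longrightarrow> inner_at c y u v = inner_at c y v u"
  by (simp add: inner_at_def sum_2 metric_coeff_sym[of c y 2 1])

lemma linear_connection_term: "linear (\<lambda>u. connection_term c y u v)"
  by (rule linearI) (simp_all add: connection_term_def vec_eq_iff sum_2 algebra_simps)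

text \<open>This is the product rule for the metric pairing of two vector fields E and F along P.
  The pairing is constant, so its derivative vanishes; \<open>metric_compatible\<close> turns the
  derivative of the coefficients into the Christoffel terms that complete the covariant
  derivatives.\<close>

lemma parallel_metric:
  assumes c: "c \<in> A"
    and ev: "\<forall>\<^sub>F w in nhds z. P w \<in> fst c \<and> E w \<in> tangent A (P w) \<and> F w \<in> tangent A (P w) \<and>
        g (P w) (E w) (F w) = k"
    and L: "((\<lambda>w. snd c (P w)) has_derivative L) (at z)"
    and DE: "((\<lambda>w. E w c) has_derivative DE) (at z)"
    and DF: "((\<lambda>w. F w c) has_derivative DF) (at z)"
  shows "inner_at c (snd c (P z)) (DE \<xi> + connection_term c (snd c (P z)) (L \<xi>) (E z c)) (F z c) +
    inner_at c (snd c (P z)) (E z c) (DF \<xi> + connection_term c (snd c (P z)) (L \<xi>) (F z c)) = 0"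
proof -
  define y where "y = snd c (P z)"
  have y: "y \<in> snd c ` fst c" using eventually_nhds_x_imp_x[OF ev] by (simp add: y_def)
  \<comment> \<open>The chain rule is expanded in partial derivatives, the form to which
    \<open>metric_compatible\<close> applies.\<close>
  define DG where "DG i j \<zeta> = (\<Sum>k\<in>UNIV. L \<zeta> $ k * pderiv_at k (\<lambda>w. G c w $ i $ j) y)" for i j \<zeta>
  have DG: "((\<lambda>w. G c (snd c (P w)) $ i $ j) has_derivative DG i j) (at z)" for i j
  proof -
    let ?D = "frechet_derivative (\<lambda>w. G c w $ i $ j) (at y)"
    note d = metric_coeff_differentiable[OF c y, of i j]
    have lin: "linear ?D" using d by (rule linear_frechet_derivative)
    have "(\<lambda>w. G c w $ i $ j) differentiable (at (snd c (P z)))"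
      using d by (simp add: y_def)
    then have "((\<lambda>w. G c w $ i $ j) has_derivative ?D) (at (snd c (P z)))"
      by (simp add: frechet_derivative_works y_def)
    from diff_chain_at[OF L this]
    have "((\<lambda>w. G c (snd c (P w)) $ i $ j) has_derivative (\<lambda>\<zeta>. ?D (L \<zeta>))) (at z)"
      by (simp add: o_def)
    moreover have "?D (L \<zeta>) = DG i j \<zeta>" for \<zeta>
      by (subst vec2_eq[of "L \<zeta>"]) (simp add: DG_def sum_2 pderiv_at_def linear_add[OF lin] linear_scale[OF lin])
    ultimately show ?thesis by simp
  qed
  have "((\<lambda>w. \<Sum>i\<in>UNIV. \<Sum>j\<in>UNIV. G c (snd c (P w)) $ i $ j * E w c $ i * F w c $ j) has_derivative
     (\<lambda>\<zeta>. \<Sum>i\<in>UNIV. \<Sum>j\<in>UNIV. G c (snd c (P z)) $ i $ j * E z c $ i * DF \<zeta> $ j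
        + (G c (snd c (P z)) $ i $ j * DE \<zeta> $ i + DG i j \<zeta> * E z c $ i) * F z c $ j)) (at z)"
    by (intro has_derivative_sum has_derivative_mult DG nth_has_derivative DE DF)
  moreover have "\<forall>\<^sub>F w in nhds z. (\<Sum>i\<in>UNIV. \<Sum>j\<in>UNIV. G c (snd c (P w)) $ i $ j * E w c $ i * F w c $ j) = k"
    using ev
  proof eventually_elim
    case (elim w)
    then show ?case using metric_coords[OF c, of "P w" "E w" "F w"] by simp
  qed
  ultimately have "((\<lambda>w. k) has_derivative
     (\<lambda>\<zeta>. \<Sum>i\<in>UNIV. \<Sum>j\<in>UNIV. G c (snd c (P z)) $ i $ j * E z c $ i * DF \<zeta> $ j
        + (G c (snd c (P z)) $ i $ j * DE \<zeta> $ i + DG i j \<zeta> * E z c $ i) * F z c $ j)) (at z)"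
    by (rule has_derivative_transform_nhds)
  from has_derivative_unique[OF this has_derivative_const]
  have 0: "(\<Sum>i\<in>UNIV. \<Sum>j\<in>UNIV. G c y $ i $ j * E z c $ i * DF \<xi> $ j
        + (G c y $ i $ j * DE \<xi> $ i + DG i j \<xi> * E z c $ i) * F z c $ j) = 0"
    by (simp add: fun_eq_iff y_def)
  show ?thesis
    using 0 unfolding y_def[symmetric] DG_def metric_compatible[OF c y] inner_at_def connection_term_def
    by (simp add: sum_2 metric_coeff_sym[OF c y, of 2 1] algebra_simps)
qed

text \<open>The covariant derivatives of the frame vectors are \<open>\<omega> e\<^sub>2\<close> and \<open>- \<omega> e\<^sub>1\<close> for a linear form \<open>\<omega>\<close>
  (the connection form) which is \<open>1\<close> on \<open>\<partial>\<^sub>\<phi>\<close>.\<close>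

lemma frame_connection:
  assumes q: "q \<in> carrier SO"
  defines "b \<equiv> chart_at SO q" and "c' \<equiv> chart_at A (fst q)"
  obtains C1 C2 :: "real^3 \<Rightarrow> real^2" where
    "linear C1" "linear C2"
    "\<And>X. cov_deriv A g (\<lambda>q. fst (snd q)) q X = C1 (X b)"
    "\<And>X. cov_deriv A g (\<lambda>q. snd (snd q)) q X = C2 (X b)"
    "C1 (axis 3 1) = snd (snd q) c'" "C2 (axis 3 1) = - fst (snd q) c'"
    "\<And>\<xi>. \<exists>s. C1 \<xi> = s *\<^sub>R snd (snd q) c' \<and> C2 \<xi> = - s *\<^sub>R fst (snd q) c'"
proof -
  have b: "b \<in> SO" "q \<in> fst b" using chart_at[OF q] by (simp_all add: b_def)
  from b(1) obtain c a where c: "c \<in> A" "b = SO_chart A g c a" by (rule SO_atlasE)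
  note Q = SO_bundleD[OF carrier_SO_bundle[OF q]]
  have c': "c' \<in> A" "fst q \<in> fst c'" using chart_at[OF Q(1)] by (simp_all add: c'_def)
  define z where "z = snd b q"
  have z: "z \<in> frame_dom c a" "frame_param A g c z = q"
    using SO_chart_coords[OF c(1), of q a] b(2) by (simp_all add: z_def c(2))
  have z2: "fst (frame_param A g c z) \<in> fst c'" using z c' by simp
  let ?P = "\<lambda>w. fst (frame_param A g c w)"
  let ?E = "\<lambda>w. fst (snd (frame_param A g c w))"
  let ?F = "\<lambda>w. snd (snd (frame_param A g c w))"
  define y where "y = snd c' (fst q)"
  have y: "y \<in> snd c' ` fst c'" using c' by (simp add: y_def)
  define e1 e2 where "e1 = fst (snd q) c'" and "e2 = snd (snd q) c'"
  obtain D1 where D1: "((\<lambda>w. ?E w c') has_derivative D1) (at z)"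
    using frame_param_differentiable(1)[OF c(1) c'(1) z(1) z2] unfolding differentiable_def by blast
  obtain D2 where D2: "((\<lambda>w. ?F w c') has_derivative D2) (at z)"
    using frame_param_differentiable(2)[OF c(1) c'(1) z(1) z2] unfolding differentiable_def by blast
  define L where "L \<xi> = chart_deriv c c' (\<lambda>x. x) (fst q) (base_coords \<xi>)" for \<xi>
  have L: "((\<lambda>w. snd c' (?P w)) has_derivative L) (at z)"
    using base_map_has_derivative(1)[OF c(1) c'(1) z(1) z2] by (simp add: z(2) L_def[abs_def])
  note lin = has_derivative_linear[OF D1] has_derivative_linear[OF D2] has_derivative_linear[OF L]
  define C1 C2 where "C1 \<xi> = D1 \<xi> + connection_term c' y (L \<xi>) e1"
    and "C2 \<xi> = D2 \<xi> + connection_term c' y (L \<xi>) e2" for \<xi>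
  note ct = linear_connection_term[of c' y]
  have lin1: "linear C1"
    by (rule linearI) (simp_all add: C1_def linear_add[OF lin(1)] linear_add[OF lin(3)] linear_add[OF ct]
      linear_scale[OF lin(1)] linear_scale[OF lin(3)] linear_scale[OF ct] algebra_simps)
  have lin2: "linear C2"
    by (rule linearI) (simp_all add: C2_def linear_add[OF lin(2)] linear_add[OF lin(3)] linear_add[OF ct]
      linear_scale[OF lin(2)] linear_scale[OF lin(3)] linear_scale[OF ct] algebra_simps)
  \<comment> \<open>The angle does not move the base point, so the Christoffel terms of C1 and C2
    vanish in the vertical direction.\<close>
  have L3: "L (axis 3 1) = 0"
  proof -
    have "base_coords (axis 3 1) = 0" by (simp add: vec_eq_iff forall_2 axis_def)
    moreover have "linear (chart_deriv c c' (\<lambda>x. x) (fst q))"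
      by (rule linear_transition) (use c c' SO_chart_coords(3)[OF c(1), of q a] b in auto)
    ultimately show ?thesis by (simp add: L_def linear_0)
  qed
  have shift: "((\<lambda>t. z + t *\<^sub>R axis 3 1) has_derivative (\<lambda>t. t *\<^sub>R axis 3 1)) (at (0::real))"
    by (auto intro!: derivative_eq_intros)
  \<comment> \<open>Along the fibre the first vector is cos t e1 + sin t e2, with velocity e2 at t =
    0; likewise the second one has velocity - e1.\<close>
  have D13: "D1 (axis 3 1) = e2"
  proof -
    have "((\<lambda>t. ?E (z + t *\<^sub>R axis 3 1) c') has_derivative (\<lambda>t. D1 (t *\<^sub>R axis 3 1))) (at 0)"
      using diff_chain_at[OF shift, of "\<lambda>w. ?E w c'" D1] D1 by (simp add: o_def)
    then have "((\<lambda>t. cos t *\<^sub>R e1 + sin t *\<^sub>R e2) has_derivative (\<lambda>t. D1 (t *\<^sub>R axis 3 1))) (at 0)"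
      by (simp add: frame_dom_shift(2)[OF c(1) z(1)] z(2) e1_def e2_def)
    moreover have "((\<lambda>t. cos t *\<^sub>R e1 + sin t *\<^sub>R e2) has_derivative (\<lambda>t. t *\<^sub>R e2)) (at 0)"
      by (auto intro!: derivative_eq_intros)
    ultimately have "(\<lambda>t. D1 (t *\<^sub>R axis 3 1)) = (\<lambda>t. t *\<^sub>R e2)"
      by (rule has_derivative_unique)
    from fun_cong[OF this, of 1] show ?thesis by simp
  qed
  have D23: "D2 (axis 3 1) = - e1"
  proof -
    have "((\<lambda>t. ?F (z + t *\<^sub>R axis 3 1) c') has_derivative (\<lambda>t. D2 (t *\<^sub>R axis 3 1))) (at 0)"
      using diff_chain_at[OF shift, of "\<lambda>w. ?F w c'" D2] D2 by (simp add: o_def)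
    then have "((\<lambda>t. (- sin t) *\<^sub>R e1 + cos t *\<^sub>R e2) has_derivative (\<lambda>t. D2 (t *\<^sub>R axis 3 1))) (at 0)"
      by (simp add: frame_dom_shift(2)[OF c(1) z(1)] z(2) e1_def e2_def)
    moreover have "((\<lambda>t. (- sin t) *\<^sub>R e1 + cos t *\<^sub>R e2) has_derivative (\<lambda>t. t *\<^sub>R (- e1))) (at 0)"
      by (auto intro!: derivative_eq_intros)
    ultimately have "(\<lambda>t. D2 (t *\<^sub>R axis 3 1)) = (\<lambda>t. t *\<^sub>R (- e1))"
      by (rule has_derivative_unique)
    from fun_cong[OF this, of 1] show ?thesis by simp
  qed
  have ct0: "connection_term c' y 0 v = 0" for v using linear_0[OF ct] .
  have near: "\<forall>\<^sub>F w in nhds z. w \<in> frame_dom c a \<and> ?P w \<in> fst c'"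
    by (rule base_map_has_derivative(2)[OF c(1) c'(1) z(1) z2])
  have dpi: "d_pi A g q X c' = L (X b)" for X
    using frechet_derivative_at[OF projection_chart(1)[OF c(1) c'(1), of q a, folded c(2), OF b(2) c'(2)]] c'
    by (simp add: d_pi_def differential_def dir_deriv_def Let_def flip: b_def)
      (simp add: L_def fun_eq_iff)
  have cov1: "cov_deriv A g (\<lambda>q. fst (snd q)) q X = C1 (X b)" for X
  proof -
    have "\<forall>\<^sub>F w in nhds z. ?E w c' = ((\<lambda>q. fst (snd q) c') \<circ> chart_inv b) w"
      using near by eventually_elim (simp add: c(2) SO_chart_inv[OF c(1)])
    from frechet_derivative_at[OF has_derivative_transform_nhds[OF D1 this]]
    have "dir_deriv SO (\<lambda>q. fst (snd q) c') q X = D1 (X b)"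
      by (simp add: dir_deriv_def Let_def z_def o_def flip: b_def)
    then show ?thesis
      by (simp add: cov_deriv_def Let_def C1_def connection_term_def e1_def y_def dpi flip: c'_def)
  qed
  have cov2: "cov_deriv A g (\<lambda>q. snd (snd q)) q X = C2 (X b)" for X
  proof -
    have "\<forall>\<^sub>F w in nhds z. ?F w c' = ((\<lambda>q. snd (snd q) c') \<circ> chart_inv b) w"
      using near by eventually_elim (simp add: c(2) SO_chart_inv[OF c(1)])
    from frechet_derivative_at[OF has_derivative_transform_nhds[OF D2 this]]
    have "dir_deriv SO (\<lambda>q. snd (snd q) c') q X = D2 (X b)"
      by (simp add: dir_deriv_def Let_def z_def o_def flip: b_def)
    then show ?thesis
      by (simp add: cov_deriv_def Let_def C2_def connection_term_def e2_def y_def dpi flip: c'_def)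
  qed
  \<comment> \<open>Orthonormality holds at all frames near q, so its three relations can be
    differentiated. The results i11, i22 and i12 say that the coefficients of C1 and C2 in the basis
    (e1, e2) form a skew matrix.\<close>
  have B: "frame_param A g c w \<in> SO_bundle A g" if "w \<in> frame_dom c a" for w
    by (rule frame_param_SO_bundle[OF c(1) that])
  have "\<forall>\<^sub>F w in nhds z. ?P w \<in> fst c' \<and> ?E w \<in> tangent A (?P w) \<and> ?E w \<in> tangent A (?P w) \<and> g (?P w) (?E w) (?E w) = 1"
    using near by eventually_elim (use B SO_bundleD in blast)
  from parallel_metric[OF c'(1) this L D1 D1]
  have i11: "inner_at c' y (C1 \<xi>) e1 + inner_at c' y e1 (C1 \<xi>) = 0" for \<xi>
    by (simp add: C1_def y_def e1_def z(2))
  have "\<forall>\<^sub>F w in nhds z. ?P w \<in> fst c' \<and> ?F w \<in> tangent A (?P w) \<and> ?F w \<in> tangent A (?P w) \<and> g (?P w) (?F w) (?F w) = 1"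
    using near by eventually_elim (use B SO_bundleD in blast)
  from parallel_metric[OF c'(1) this L D2 D2]
  have i22: "inner_at c' y (C2 \<xi>) e2 + inner_at c' y e2 (C2 \<xi>) = 0" for \<xi>
    by (simp add: C2_def y_def e2_def z(2))
  have "\<forall>\<^sub>F w in nhds z. ?P w \<in> fst c' \<and> ?E w \<in> tangent A (?P w) \<and> ?F w \<in> tangent A (?P w) \<and> g (?P w) (?E w) (?F w) = 0"
    using near by eventually_elim (use B SO_bundleD in blast)
  from parallel_metric[OF c'(1) this L D1 D2]
  have i12: "inner_at c' y (C1 \<xi>) e2 + inner_at c' y e1 (C2 \<xi>) = 0" for \<xi>
    by (simp add: C1_def C2_def y_def e1_def e2_def z(2))
  note sym = inner_at_sym[OF c'(1) y]
  have o11: "inner_at c' y e1 e1 = 1" and o22: "inner_at c' y e2 e2 = 1" and o12: "inner_at c' y e1 e2 = 0"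
    using Q(4-6) metric_coords[OF c'] Q(2,3) by (simp_all add: inner_at_def y_def e1_def e2_def)
  have det: "det (vector [e1, e2] :: real^2^2) \<noteq> 0"
    using Q(7)[OF c'] by (simp add: e1_def e2_def)
  have expand: "v = inner_at c' y v e1 *\<^sub>R e1 + inner_at c' y v e2 *\<^sub>R e2" for v
  proof -
    obtain r s where v: "v = r *\<^sub>R e1 + s *\<^sub>R e2" by (rule dim2_expansion[OF det])
    show ?thesis
      unfolding v inner_at_add using o11 o22 o12 sym[of e2 e1] by simp
  qed
  \<comment> \<open>A skew 2 by 2 matrix has one free entry; the witness s is the inner product of
    C1 with e2, the value of the connection form.\<close>
  have "\<exists>s. C1 \<xi> = s *\<^sub>R e2 \<and> C2 \<xi> = - s *\<^sub>R e1" for \<xi>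
  proof (intro exI conjI)
    show "C1 \<xi> = inner_at c' y (C1 \<xi>) e2 *\<^sub>R e2"
      using expand[of "C1 \<xi>"] i11[of \<xi>] sym[of e1 "C1 \<xi>"] by simp
    show "C2 \<xi> = - inner_at c' y (C1 \<xi>) e2 *\<^sub>R e1"
      using expand[of "C2 \<xi>"] i22[of \<xi>] i12[of \<xi>] sym[of e2 "C2 \<xi>"] sym[of e1 "C2 \<xi>"]
      by (simp add: add_eq_0_iff)
  qed
  moreover have "C1 (axis 3 1) = e2" "C2 (axis 3 1) = - e1"
    by (simp_all add: C1_def C2_def D13 D23 L3 ct0)
  ultimately show ?thesis
    using that[OF lin1 lin2 cov1 cov2] by (simp add: e1_def e2_def)
qed

text \<open>The content is uniqueness in the definite description: subtracting a multiple a of the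
  generator changes C1 by a e2, and e2 is nonzero because the frame has nonzero determinant.\<close>

lemma horizontal_vert_coeff:
  assumes q: "q \<in> carrier SO" and Y: "Y \<in> horizontal A g q"
  shows "vert_coeff A g q Y = 0"
proof -
  obtain C1 C2 where C: "linear (C1 :: real^3 \<Rightarrow> real^2)"
    "\<And>X. cov_deriv A g (\<lambda>q. fst (snd q)) q X = C1 (X (chart_at SO q))"
    "C1 (axis 3 1) = snd (snd q) (chart_at A (fst q))"
    using frame_connection[OF q] by metis
  note Q = SO_bundleD[OF carrier_SO_bundle[OF q]]
  have "snd (snd q) (chart_at A (fst q)) \<noteq> 0"
    using Q(7)[OF chart_at[OF Q(1)]] by (auto simp: det_2)
  then have nz: "C1 (axis 3 1) \<noteq> 0" using C(3) by simp
  show ?thesis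
    unfolding vert_coeff_def
  proof (rule the_equality)
    show "(\<lambda>b. Y b - 0 *\<^sub>R vert_gen A g q b) \<in> horizontal A g q" using Y by simp
    fix a assume "(\<lambda>b. Y b - a *\<^sub>R vert_gen A g q b) \<in> horizontal A g q"
    then have "C1 (Y (chart_at SO q) - a *\<^sub>R axis 3 1) = 0"
      unfolding horizontal_def using C(2) vert_gen_chart[OF chart_at[OF q]] by simp
    moreover have "C1 (Y (chart_at SO q)) = 0"
      using Y unfolding horizontal_def using C(2) by simp
    ultimately have "a *\<^sub>R C1 (axis 3 1) = 0"
      by (simp add: linear_diff[OF C(1)] linear_scale[OF C(1)])
    then show "a = 0" using nz by simp
  qed
qed

lemma horizontal_lift:
  assumes SO: "differentiable_atlas SO" and q: "q \<in> carrier SO" and u: "u \<in> tangent A (fst q)"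
  obtains Y where "Y \<in> horizontal A g q" "d_pi A g q Y = u"
proof -
  define b where "b = chart_at SO q"
  have b: "b \<in> SO" "q \<in> fst b" using chart_at[OF q] by (simp_all add: b_def)
  from b(1) obtain c a where c: "c \<in> A" "b = SO_chart A g c a" by (rule SO_atlasE)
  have cq: "fst q \<in> fst c" using SO_chart_coords(3)[OF c(1), of q a] b c by simp
  obtain C1 C2 where C: "linear (C1 :: real^3 \<Rightarrow> real^2)" "linear (C2 :: real^3 \<Rightarrow> real^2)"
    "\<And>X. cov_deriv A g (\<lambda>q. fst (snd q)) q X = C1 (X b)"
    "\<And>X. cov_deriv A g (\<lambda>q. snd (snd q)) q X = C2 (X b)"
    "C1 (axis 3 1) = snd (snd q) (chart_at A (fst q))" "C2 (axis 3 1) = - fst (snd q) (chart_at A (fst q))"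
    "\<And>\<xi>. \<exists>s. C1 \<xi> = s *\<^sub>R snd (snd q) (chart_at A (fst q)) \<and> C2 \<xi> = - s *\<^sub>R fst (snd q) (chart_at A (fst q))"
    unfolding b_def by (rule frame_connection[OF q]) blast
  \<comment> \<open>Any vector over u serves as a start; the angle component 0 is arbitrary. By the
    connection form, C1 and C2 take on it the same multiple s of their vertical values, so a single
    vertical correction kills both without changing the projection.\<close>
  define \<xi> :: "real^3" where "\<xi> = vector [u c $ 1, u c $ 2, 0]"
  obtain s where s: "C1 \<xi> = s *\<^sub>R C1 (axis 3 1)" "C2 \<xi> = s *\<^sub>R C2 (axis 3 1)"
    using C(7)[of \<xi>] C(5,6) by auto
  define Y where "Y = tvec_of SO b q (\<xi> - s *\<^sub>R axis 3 1)"
  have Yt: "Y \<in> tangent SO q" unfolding Y_def by (rule tvec_of_tangent[OF SO b])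
  have Yb: "Y b = \<xi> - s *\<^sub>R axis 3 1" unfolding Y_def by (rule tvec_of_self[OF SO b])
  have "Y \<in> horizontal A g q"
    unfolding horizontal_def
    using Yt s by (simp add: C(3,4) Yb linear_diff[OF C(1)] linear_scale[OF C(1)] linear_diff[OF C(2)] linear_scale[OF C(2)])
  moreover have "d_pi A g q Y = u"
  proof (rule tangent_eqI[OF _ u c(1) cq])
    show "d_pi A g q Y \<in> tangent A (fst q)"
      unfolding d_pi_def by (rule differential_tangent[OF SO atlas projection_differentiable[OF q] Yt])
    have "base_coords (Y b) = u c"
      by (simp add: Yb \<xi>_def vec_eq_iff forall_2 axis_def)
    moreover have "d_pi A g q Y c = chart_deriv c c (\<lambda>x. x) (fst q) (base_coords (Y b))"
      unfolding d_pi_def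
      using differential_eq[OF SO projection_differentiable[OF q] Yt b(1) c(1) b(2) cq]
        projection_chart_deriv[OF c(1) c(1), of q a] b cq c(2) by simp
    ultimately show "d_pi A g q Y c = u c"
      using tangentD[OF u c(1) c(1) cq cq] by simp
  qed
  ultimately show ?thesis by (rule that)
qed

section \<open>Projections of isometries of the Wagner lift\<close>

lemma wagner_lift_ge: "g (fst q) (d_pi A g q Y) (d_pi A g q Y) \<le> wagner_lift A g q Y Y"
  by (simp add: wagner_lift_def)

lemma wagner_lift_horizontal:
  "q \<in> carrier SO \<Longrightarrow> Y \<in> horizontal A g q \<Longrightarrow>
    wagner_lift A g q Y Y = g (fst q) (d_pi A g q Y) (d_pi A g q Y)"
  by (simp add: wagner_lift_def horizontal_vert_coeff)

text \<open>The factors 1 are kept so that the sum has the literal shape of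
  \<open>tangent_lincomb\<close>, \<open>metric_lincomb_left\<close> and
  \<open>differential_lincomb\<close>.\<close>

lemma metric_add:
  assumes "x \<in> carrier A" "u \<in> tangent A x" "v \<in> tangent A x"
  shows "g x (\<lambda>c. 1 *\<^sub>R u c + 1 *\<^sub>R v c) (\<lambda>c. 1 *\<^sub>R u c + 1 *\<^sub>R v c) = g x u u + 2 * g x u v + g x v v"
  unfolding metric_lincomb_left[OF assms tangent_lincomb[OF atlas assms]]
    metric_lincomb_right[OF assms assms(2)] metric_lincomb_right[OF assms assms(3)]
  using metric_sym[OF assms] by simp

lemma projection_carrier: "q \<in> carrier SO \<Longrightarrow> fst q \<in> carrier A"
  using SO_bundleD(1)[OF carrier_SO_bundle] .

section \<open>A diffeomorphism of the bundle lying over a diffeomorphism of the surface\<close>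

context
  fixes fh f
  assumes diff_fh: "diffeomorphism SO SO fh" and proj: "projects_to A g fh f"
begin

lemma SO_atlas_differentiable: "differentiable_atlas SO"
  by (rule diffeomorphism_imp_differentiable_atlas[OF diff_fh inj_SO inj_SO])

lemma diff_f: "diffeomorphism A A f"
  using proj by (simp add: projects_to_def)

lemma fh_base: "q \<in> carrier SO \<Longrightarrow> fst (fh q) = f (fst q)"
  using proj carrier_SO_bundle by (auto simp: projects_to_def)

lemma fh_carrier: "q \<in> carrier SO \<Longrightarrow> fh q \<in> carrier SO"
  by (rule diffeomorphism_inv(1)[OF diff_fh])

lemma fh_differentiable: "q \<in> carrier SO \<Longrightarrow> differentiable_map_at SO SO fh q"
  by (rule diffeomorphism_differentiable(1)[OF diff_fh inj_SO inj_SO])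

lemma f_differentiable: "x \<in> carrier A \<Longrightarrow> differentiable_map_at A A f x"
  using diffeomorphism_differentiable(1)[OF diff_f] inj_chart by blast

lemma base_comp_differentiable: "q \<in> carrier SO \<Longrightarrow> differentiable_map_at SO A (fst \<circ> fh) q"
  using differentiable_map_at_comp[OF inj_SO inj_SO fh_differentiable projection_differentiable[OF fh_carrier]]
  by blast

text \<open>The chain rule is applied to both sides of the projection identity, which holds only on
  \<open>carrier SO\<close>; \<open>differential_cong\<close> bridges the two composites.\<close>

lemma d_pi_differential:
  assumes q: "q \<in> carrier SO" and Y: "Y \<in> tangent SO q"
  shows "d_pi A g (fh q) (differential SO SO fh q Y) = differential A A f (fst q) (d_pi A g q Y)"
proof -
  note SO = SO_atlas_differentiable
  have "d_pi A g (fh q) (differential SO SO fh q Y) = differential SO A (fst \<circ> fh) q Y"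
    unfolding d_pi_def
    by (rule differential_comp[OF SO SO fh_differentiable[OF q] projection_differentiable[OF fh_carrier[OF q]] Y])
  also have "\<dots> = differential SO A (f \<circ> fst) q Y"
    by (rule differential_cong[OF SO base_comp_differentiable[OF q] _ Y, symmetric]) (simp add: fh_base)
  also have "\<dots> = differential A A f (fst q) (d_pi A g q Y)"
    unfolding d_pi_def
    by (rule differential_comp[OF SO atlas projection_differentiable[OF q]
      f_differentiable[OF projection_carrier[OF q]] Y, symmetric])
  finally show ?thesis .
qed

lemma metric_norm_preserved:
  assumes iso: "isometry SO (wagner_lift A g) SO (wagner_lift A g) fh"
    and x: "x \<in> carrier A" and u: "u \<in> tangent A x"
  shows "g (f x) (differential A A f x u) (differential A A f x u) = g x u u"
proof -
  note SO = SO_atlas_differentiable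
  obtain q where q: "q \<in> carrier SO" "fst q = x"
    using SO_fibre[OF chart_at[OF x]] carrierI SO_chart_in chart_at(1)[OF x] by metis
  have W: "wagner_lift A g (fh q) (differential SO SO fh q Y) (differential SO SO fh q Y) = wagner_lift A g q Y Y"
    if "Y \<in> tangent SO q" for Y
    using iso q that by (simp add: isometry_def)
  let ?du = "differential A A f x u"
  have fx: "fst (fh q) = f x" using fh_base q by simp
  note fq = fh_carrier[OF q(1)]
  note inter = d_pi_differential[OF q(1), unfolded q(2)]
  have dfx: "differentiable_map_at A A f x" by (rule f_differentiable[OF x])
  have du: "?du \<in> tangent A (f x)" by (rule differential_tangent[OF atlas atlas dfx u])
  show ?thesis
  proof (rule antisym)
    obtain Y where Y: "Y \<in> horizontal A g q" "d_pi A g q Y = u"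
      using horizontal_lift[OF SO q(1)] u q(2) by metis
    have Yt: "Y \<in> tangent SO q" using Y(1) by (simp add: horizontal_def)
    have "g (f x) ?du ?du \<le> wagner_lift A g (fh q) (differential SO SO fh q Y) (differential SO SO fh q Y)"
      using wagner_lift_ge[of "fh q" "differential SO SO fh q Y"] by (simp add: fx inter[OF Yt] Y(2))
    also have "\<dots> = g x u u"
      using wagner_lift_horizontal[OF q(1) Y(1)] by (simp add: W[OF Yt] Y(2) q(2))
    finally show "g (f x) ?du ?du \<le> g x u u" .
  next
    obtain Z where Z: "Z \<in> horizontal A g (fh q)" "d_pi A g (fh q) Z = ?du"
      using horizontal_lift[OF SO fq] du fx by metis
    have Zt: "Z \<in> tangent SO (fh q)" using Z(1) by (simp add: horizontal_def)
    \<comment> \<open>Horizontality of this pulled-back vector is not established. Equality of the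
      two forms is therefore used at Z and only the inequality at Y.\<close>
    define Y where "Y = differential SO SO (inv_into (carrier SO) fh) (fh q) Z"
    have Yt: "Y \<in> tangent SO q"
      using differential_tangent[OF SO SO diffeomorphism_differentiable(2)[OF diff_fh inj_SO inj_SO fq] Zt]
        diffeomorphism_inv(2)[OF diff_fh q(1)] by (simp add: Y_def)
    have YZ: "differential SO SO fh q Y = Z"
      unfolding Y_def by (rule diffeomorphism_differential_inv(2)[OF diff_fh SO SO q(1) Zt])
    have pY: "d_pi A g q Y \<in> tangent A x"
      using differential_tangent[OF SO atlas projection_differentiable[OF q(1)] Yt] by (simp add: d_pi_def q(2))
    have "differential A A f x (d_pi A g q Y) = ?du"
      using inter[OF Yt] Z(2) by (simp add: YZ)
    \<comment> \<open>Both vectors have the same image under the differential of f, which is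
      injective because f is a diffeomorphism.\<close>
    then have "d_pi A g q Y = u"
      by (metis diffeomorphism_differential_inv(1)[OF diff_f atlas atlas x] pY u)
    then have "g x u u \<le> wagner_lift A g q Y Y"
      using wagner_lift_ge[of q Y] q(2) by simp
    also have "\<dots> = g (f x) ?du ?du"
      using wagner_lift_horizontal[OF fq Z(1)] W[OF Yt] by (simp add: YZ Z(2) fx)
    finally show "g x u u \<le> g (f x) ?du ?du" .
  qed
qed

lemma projection_isometry:
  assumes iso: "isometry SO (wagner_lift A g) SO (wagner_lift A g) fh"
  shows "isometry A g A g f"
  unfolding isometry_def
proof (intro conjI ballI)
  show "diffeomorphism A A f" by (rule diff_f)
  fix x u v assume x: "x \<in> carrier A" and u: "u \<in> tangent A x" and v: "v \<in> tangent A x"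
  let ?d = "differential A A f x"
  note dfx = f_differentiable[OF x]
  have fx: "f x \<in> carrier A" by (rule diffeomorphism_inv(1)[OF diff_f x])
  have t: "?d u \<in> tangent A (f x)" "?d v \<in> tangent A (f x)"
    using differential_tangent[OF atlas atlas dfx] u v by blast+
  note N = metric_norm_preserved[OF iso x]
  have "g (f x) (?d u) (?d u) + 2 * g (f x) (?d u) (?d v) + g (f x) (?d v) (?d v) = g x u u + 2 * g x u v + g x v v"
    using N[OF tangent_lincomb[OF atlas x u v, of 1 1]]
    unfolding differential_lincomb[OF atlas dfx u v] metric_add[OF x u v] metric_add[OF fx t] .
  then show "g (f x) (?d u) (?d v) = g x u v"
    using N[OF u] N[OF v] by simp
qed

text \<open>This determines the first two rows of the Jacobian of \<open>fh\<close>. In the charts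
  used, \<open>base_coords\<close> is the differential of the projection, so both sides are
  derivatives of the common composite \<open>fst \<circ> fh\<close> =
  \<open>f \<circ> fst\<close>.\<close>

lemma chart_deriv_projection:
  assumes q: "q \<in> carrier SO" and c: "c \<in> A" "c' \<in> A"
    and b: "q \<in> fst (SO_chart A g c a)" "fh q \<in> fst (SO_chart A g c' a')"
  shows "base_coords (chart_deriv (SO_chart A g c a) (SO_chart A g c' a') fh q \<xi>) =
    chart_deriv c c' f (fst q) (base_coords \<xi>)"
proof -
  let ?b = "SO_chart A g c a" and ?b' = "SO_chart A g c' a'"
  note SO = SO_atlas_differentiable
  have m: "fst q \<in> fst c" "f (fst q) \<in> fst c'" "fst (fh q) \<in> fst c'"
    using SO_chart_coords(3)[OF c(1) b(1)] SO_chart_coords(3)[OF c(2) b(2)] fh_base[OF q] by simp_all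
  have self: "chart_deriv d d (\<lambda>x. x) x w = w" if "d \<in> A" "x \<in> fst d" for d x w
    using tvec_of_self[OF atlas that, of w] tvec_of_eq[OF that, of d w] by simp
  have "base_coords (chart_deriv ?b ?b' fh q \<xi>) = chart_deriv ?b' c' fst (fh q) (chart_deriv ?b ?b' fh q \<xi>)"
    using projection_chart_deriv[OF c(2) c(2) b(2) m(3)] self[OF c(2) m(3)] by simp
  also have "\<dots> = chart_deriv ?b c' (fst \<circ> fh) q \<xi>"
    by (rule chart_deriv_comp[OF inj_SO_chart[OF c(1)] inj_SO_chart[OF c(2)] fh_differentiable[OF q]
      projection_differentiable[OF fh_carrier[OF q]], symmetric]) (use c b m SO_chart_in in auto)
  also have "\<dots> = chart_deriv ?b c' (f \<circ> fst) q \<xi>"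
    by (subst chart_deriv_cong[OF base_comp_differentiable[OF q], of "f \<circ> fst"])
      (use c b m SO_chart_in in \<open>auto simp: fh_base\<close>)
  also have "\<dots> = chart_deriv c c' f (fst q) (chart_deriv ?b c fst q \<xi>)"
    by (rule chart_deriv_comp[OF inj_SO_chart[OF c(1)] inj_chart[OF c(1)] projection_differentiable[OF q]
      f_differentiable[OF projection_carrier[OF q]]]) (use c b m SO_chart_in in auto)
  also have "\<dots> = chart_deriv c c' f (fst q) (base_coords \<xi>)"
    using projection_chart_deriv[OF c(1) c(1) b(1) m(1)] self[OF c(1) m(1)] by simp
  finally show ?thesis .
qed

lemma projection_orientation_preserving:
  assumes op: "orientation_preserving SO SO fh" and fop: "fibre_orientation_preserving A g fh"
  shows "orientation_preserving A A f"
  unfolding orientation_preserving_def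
proof (intro ballI impI)
  fix c c' x assume c: "c \<in> A" "c' \<in> A" "x \<in> fst c" "f x \<in> fst c'"
  have x: "x \<in> carrier A" using c by (auto intro: carrierI)
  have fx: "f x \<in> carrier A" using c by (auto intro: carrierI)
  obtain q where q: "q \<in> carrier SO" "fst q = x"
    using SO_fibre[OF c(1,3)] carrierI SO_chart_in c(1) by metis
  \<comment> \<open>The chart at q is the one in which \<open>differential\<close> is computed, so
    the image of the vertical generator is read off directly as a column of M. The base charts c0
    and c1 are then dictated by the bundle charts, not by c and c'.\<close>
  have "chart_at SO q \<in> SO" "q \<in> fst (chart_at SO q)" using chart_at[OF q(1)] by auto
  then obtain c0 a0 where c0: "c0 \<in> A" "chart_at SO q = SO_chart A g c0 a0" "q \<in> fst (SO_chart A g c0 a0)"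
    by (metis SO_atlasE)
  obtain c1 a1 where c1: "c1 \<in> A" "fh q \<in> fst (SO_chart A g c1 a1)"
    using carrier_SO_E[OF fh_carrier[OF q(1)]] by metis
  have m: "x \<in> fst c0" "f x \<in> fst c1"
    using SO_chart_coords(3)[OF c0(1,3)] SO_chart_coords(3)[OF c1] fh_base[OF q(1)] q(2) by simp_all
  let ?b = "SO_chart A g c0 a0" and ?b' = "SO_chart A g c1 a1"
  define M where "M = chart_deriv ?b ?b' fh q"
  define N where "N = chart_deriv c0 c1 f x"
  note b = SO_chart_in[OF c0(1), of a0] SO_chart_in[OF c1(1), of a1]
  have detM: "det (matrix M) > 0"
    using op b c0(3) c1(2) unfolding orientation_preserving_def M_def chart_deriv_def by blast
  obtain t where t: "t > 0" "differential SO SO fh q (vert_gen A g q) = (\<lambda>b. t *\<^sub>R vert_gen A g (fh q) b)"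
    using fop carrier_SO_bundle[OF q(1)] unfolding fibre_orientation_preserving_def by blast
  have "differential SO SO fh q (vert_gen A g q) ?b' = M (axis 3 1)"
    using b c1(2) vert_gen_chart[OF b(1) c0(3)]
    by (simp add: differential_def dir_deriv_def M_def chart_deriv_def Let_def c0(2) o_assoc)
  then have M3: "M (axis 3 1) = t *\<^sub>R axis 3 1"
    using t(2) vert_gen_chart[OF b(2) c1(2)] by simp
  have M3': "M (axis 3 1) $ 1 = 0" "M (axis 3 1) $ 2 = 0" "M (axis 3 1) $ 3 = t"
    unfolding M3 by (simp_all add: axis_def)
  have MN: "base_coords (M \<xi>) = N (base_coords \<xi>)" for \<xi>
    using chart_deriv_projection[OF q(1) c0(1) c1(1) c0(3) c1(2)] q(2) by (simp add: M_def N_def)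
  have bc: "base_coords (axis 1 1) = axis 1 1" "base_coords (axis 2 1) = axis 2 1"
    by (simp_all add: vec_eq_iff forall_2 axis_def)
  have "M (axis 1 1) $ i = N (axis 1 1) $ j" "M (axis 2 1) $ i = N (axis 2 1) $ j"
    if "i = 1 \<and> j = 1 \<or> i = 2 \<and> j = 2" for i j
    using that MN[of "axis 1 1"] MN[of "axis 2 1"] bc base_coords_nth by metis+
  then have MN': "M (axis 1 1) $ 1 = N (axis 1 1) $ 1" "M (axis 2 1) $ 1 = N (axis 2 1) $ 1"
    "M (axis 1 1) $ 2 = N (axis 1 1) $ 2" "M (axis 2 1) $ 2 = N (axis 2 1) $ 2" by blast+
  \<comment> \<open>The third column of M is (0, 0, t) and the upper left block is N; the rest of
    the third row does not contribute.\<close>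
  have "det (matrix M) = t * det (matrix N)"
    unfolding det_3 det_2 matrix_def by (simp add: M3' MN' algebra_simps)
  then have detN: "det (matrix N) > 0"
    using detM t(1) by (simp add: zero_less_mult_iff)
  have linN: "linear N" unfolding N_def by (rule linear_chart_deriv[OF f_differentiable[OF x] c0(1) c1(1) m])
  \<comment> \<open>Passing from c0 and c1 to the given charts multiplies the Jacobian of f by
    transition maps with positive determinant.\<close>
  let ?R = "chart_deriv c c0 (\<lambda>x. x) x" and ?S = "chart_deriv c1 c' (\<lambda>x. x) (f x)"
  have R: "linear ?R" "det (matrix ?R) > 0"
    using linear_transition[OF c(1) c0(1) c(3) m(1)] transition_det[OF c(1) c0(1) c(3) m(1)] by auto
  have S: "linear ?S" "det (matrix ?S) > 0"
    using linear_transition[OF c1(1) c(2) m(2) c(4)] transition_det[OF c1(1) c(2) m(2) c(4)] by auto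
  have "chart_deriv c c' f x w = ?S (N (?R w))" for w
  proof -
    have "chart_deriv c c' ((\<lambda>x. x) \<circ> f) x w = ?S (chart_deriv c c1 f x w)"
      by (rule chart_deriv_comp[OF inj_chart[OF c(1)] inj_chart[OF c1(1)] f_differentiable[OF x] id_differentiable[OF fx]])
        (use c c1 m in auto)
    moreover have "chart_deriv c c1 (f \<circ> (\<lambda>x. x)) x w = N (?R w)"
      unfolding N_def
      by (rule chart_deriv_comp[OF inj_chart[OF c(1)] inj_chart[OF c0(1)] id_differentiable[OF x] f_differentiable[OF x]])
        (use c c0 c1 m in auto)
    ultimately show ?thesis by (simp add: o_def)
  qed
  then have "chart_deriv c c' f x = (\<lambda>w. ?S (N (?R w)))" by blast
  then have "det (matrix (chart_deriv c c' f x)) = det (matrix ?S) * (det (matrix N) * det (matrix ?R))"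
    using det_matrix_comp[OF linear_compose[OF R(1) linN] S(1)] det_matrix_comp[OF R(1) linN]
    by (simp add: o_def)
  then have "det (matrix (chart_deriv c c' f x)) > 0"
    using R S detN by simp
  then show "det (matrix (frechet_derivative (snd c' \<circ> f \<circ> chart_inv c) (at (snd c x)))) > 0"
    by (simp add: chart_deriv_def)
qed

end

text \<open>The preceding results hold for any map below \<open>fh\<close>, so they apply to the one
  selected by the choice operator.\<close>

lemma projects_to_pi_push: "projectable A g fh \<Longrightarrow> projects_to A g fh (pi_push A g fh)"
  unfolding projectable_def pi_push_def by (erule conjE, erule someI_ex)

end

text \<open>The metric argument involves no orientation, hence the second conjunct for all
  projectable isometries; the orientation conditions enter only through the sign of the Jacobian
  determinant in the first.\<close>

theorem theorem3p2:
  fixes X :: "'a topology" and A :: "('a, 2) chart set" and g :: "('a, 2) metric"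
  assumes "oriented_riemannian_surface X A g"
    and "\<forall>x\<in>topspace X. gauss_curvature A g x \<noteq> 0"
  shows "(\<forall>fh \<in> projectable_isometry_group A g. pi_push A g fh \<in> isometry_group A g) \<and>
    (\<forall>fh \<in> all_projectable_isometries A g. isometry A g A g (pi_push A g fh))"
proof -
  interpret oriented_surface X A g by unfold_locales (rule assms(1))
  have iso: "isometry A g A g (pi_push A g fh)"
    if "projectable A g fh" "isometry SO (wagner_lift A g) SO (wagner_lift A g) fh" for fh
    using projection_isometry[OF _ projects_to_pi_push[OF that(1)] that(2)] that(1)
    by (simp add: projectable_def)
  have "orientation_preserving A A (pi_push A g fh)"
    if "projectable A g fh" "orientation_preserving SO SO fh" "fibre_orientation_preserving A g fh" for fh
    using projection_orientation_preserving[OF _ projects_to_pi_push[OF that(1)] that(2,3)] that(1)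
    by (simp add: projectable_def)
  with iso show ?thesis
    by (auto simp: projectable_isometry_group_def all_projectable_isometries_def isometry_group_def)
qed

end
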